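(* Let $f,g_1,\ldots,g_m,h_1,\ldots,h_l\in\mathbb{R}[\mathbf{z},\overline{\mathbf{z}}]$ be self-conjugate polynomials with real coefficients, and consider the complex polynomial optimization problem $$f_{\min}=\inf\{f(\mathbf{z},\overline{\mathbf{z}}):\ \mathbf{z}\in\mathbb{C}^n,\ g_i(\mathbf{z},\overline{\mathbf{z}})\ge0\ (i=1,\ldots,m),\ h_i(\mathbf{z},\overline{\mathbf{z}})=0\ (i=1,\ldots,l)\}.$$ Suppose that the constraints include a sphere constraint $|z_1|^2+\cdots+|z_n|^2=R$ for some $R>0$ (i.e. one of the $h_i$ is $|z_1|^2+\cdots+|z_n|^2-R$). Let $r\ge\max\{d_K,d_{\min}\}$ and let $\mathbf{y}$ be an optimal solution of the real moment relaxation of order $r$. If $$\operatorname{rank}\mathbf{M}_r(\mathbf{y})=\operatorname{rank}\mathbf{M}_{r-d_K}(\mathbf{y})=2,$$ then global optimality is attained, i.e. $\theta_r=f_{\min}$. Moreover, the problem has either two (distinct) real optimal solutions, or a pair of (distinct) complex conjugate optimal solutions $\mathbf{z},\overline{\mathbf{z}}$.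
   Context: Polynomials. For $\mathbf{z}=(z_1,\ldots,z_n)$ write elements of $\mathbb{C}[\mathbf{z},\overline{\mathbf{z}}]$ as finite sums $p=\sum_{(\beta,\gamma)\in\mathbb{N}^n\times\mathbb{N}^n}p_{\beta,\gamma}\mathbf{z}^{\beta}\overline{\mathbf{z}}^{\gamma}$; $\mathbb{R}[\mathbf{z},\overline{\mathbf{z}}]$ is the subring with all $p_{\beta,\gamma}\in\mathbb{R}$. $p$ is self-conjugate if $p_{\gamma,\beta}=\overline{p_{\beta,\gamma}}$ for all $\beta,\gamma$ (so $p$ takes real values). For $\alpha\in\mathbb{N}^n$, $|\alpha|=\sum_i\alpha_i$. Degrees. $d^f=\max\{|\beta|,|\gamma|: f_{\beta,\gamma}\neq0\}$, and $d^g_i$, $d^h_i$ are defined in the same way from $g_i$, $h_i$. $d_{\min}=\max\{d^f,d^g_1,\ldots,d^g_m,d^h_1,\ldots,d^h_l\}$ and $d_K=\max\{2,d^g_1,\ldots,d^g_m,d^h_1,\ldots,d^h_l\}$. Moment and localizing matrices. A pseudo-moment sequence is $\mathbf{y}=(y_{\beta,\gamma})_{(\beta,\gamma)\in\mathbb{N}^n\times\mathbb{N}^n}$ with $y_{\beta,\gamma}=\overline{y_{\gamma,\beta}}$. Put $L_{\mathbf{y}}(p)=\sum p_{\beta,\gamma}y_{\beta,\gamma}$. For $s\in\mathbb{N}$, $\mathbf{M}_s(\mathbf{y})$ is the matrix indexed by $\{\alpha\in\mathbb{N}^n:|\alpha|\le s\}$ with entries $[\mathbf{M}_s(\mathbf{y})]_{\beta\gamma}=y_{\beta,\gamma}$;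 for a polynomial $g$, $\mathbf{M}_s(g\mathbf{y})$ has the same index set and entries $[\mathbf{M}_s(g\mathbf{y})]_{\beta\gamma}=\sum_{(\beta',\gamma')}g_{\beta',\gamma'}\,y_{\beta+\beta',\gamma+\gamma'}$. $A\succeq0$ means $A$ is (Hermitian) positive semidefinite. Relaxations of order $r\ge d_{\min}$. The complex moment relaxation has optimal value $\theta_r$, the infimum of $L_{\mathbf{y}}(f)$ over complex pseudo-moment sequences $\mathbf{y}$ satisfying $\mathbf{M}_r(\mathbf{y})\succeq0$, $\mathbf{M}_{r-d^g_i}(g_i\mathbf{y})\succeq0$ for $i=1,\ldots,m$, $\mathbf{M}_{r-d^h_i}(h_i\mathbf{y})=0$ for $i=1,\ldots,l$, and $y_{\mathbf{0},\mathbf{0}}=1$. The real moment relaxation is the same problem restricted to sequences with all $y_{\beta,\gamma}\in\mathbb{R}$; an optimal solution of it is a feasible real sequence attaining the infimum. An optimal solution of the polynomial optimization problem is a feasible point $\mathbf{z}\in\mathbb{C}^n$ with $f(\mathbf{z},\overline{\mathbf{z}})=f_{\min}$; it is real if $\mathbf{z}\in\mathbb{R}^n$. *)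

theory Defs
  imports
    "HOL-Analysis.Analysis"
    "HOL-Library.Poly_Mapping"
    "HOL-Library.Function_Algebras"
    "HOL-Library.Extended_Real"
begin

section \<open>Polynomials in z and its conjugate\<close>

text \<open>
  The variables are indexed by a finite type \<open>'n\<close>, so \<open>n = CARD('n)\<close>. A multi-index is an element
  of \<open>'n \<Rightarrow>\<^sub>0 nat\<close>; the coefficient of \<open>z\<^sup>\<beta> cnj z\<^sup>\<gamma>\<close> in \<open>p\<close> is \<open>Poly_Mapping.lookup p (\<beta>, \<gamma>)\<close>.
\<close>

type_synonym 'n mindex = "'n \<Rightarrow>\<^sub>0 nat"
type_synonym 'n cpoly = "('n mindex \<times> 'n mindex) \<Rightarrow>\<^sub>0 complex"

definition mdeg :: "'n::finite mindex \<Rightarrow> nat" where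
  "mdeg \<alpha> = (\<Sum>i\<in>UNIV. Poly_Mapping.lookup \<alpha> i)"

definition monom_eval :: "complex ^ 'n::finite \<Rightarrow> 'n mindex \<Rightarrow> complex" where
  "monom_eval z \<alpha> = (\<Prod>i\<in>UNIV. (z $ i) ^ Poly_Mapping.lookup \<alpha> i)"

definition vcnj :: "complex ^ 'n::finite \<Rightarrow> complex ^ 'n" where
  "vcnj z = (\<chi> i. cnj (z $ i))"

definition real_point :: "complex ^ 'n::finite \<Rightarrow> bool" where
  "real_point z \<longleftrightarrow> (\<forall>i. z $ i \<in> \<real>)"

definition cpoly_eval :: "'n::finite cpoly \<Rightarrow> complex ^ 'n \<Rightarrow> complex" where
  "cpoly_eval p z =
     (\<Sum>(\<beta>, \<gamma>)\<in>Poly_Mapping.keys p. Poly_Mapping.lookup p (\<beta>, \<gamma>) * monom_eval z \<beta> * monom_eval (vcnj z) \<gamma>)"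

definition real_coeffs :: "'n cpoly \<Rightarrow> bool" where
  "real_coeffs p \<longleftrightarrow> (\<forall>\<beta> \<gamma>. Poly_Mapping.lookup p (\<beta>, \<gamma>) \<in> \<real>)"

definition self_conjugate :: "'n cpoly \<Rightarrow> bool" where
  "self_conjugate p \<longleftrightarrow> (\<forall>\<beta> \<gamma>. Poly_Mapping.lookup p (\<gamma>, \<beta>) = cnj (Poly_Mapping.lookup p (\<beta>, \<gamma>)))"

text \<open>The larger of the degrees in \<open>z\<close> and in its conjugate, not the total degree; it is 0 for the
  zero polynomial.\<close>

definition cdeg :: "'n::finite cpoly \<Rightarrow> nat" where
  "cdeg p = Max (insert 0 ((\<lambda>(\<beta>, \<gamma>). max (mdeg \<beta>) (mdeg \<gamma>)) ` Poly_Mapping.keys p))"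

text \<open>\<open>|z\<^sub>1|\<^sup>2 + \<dots> + |z\<^sub>n|\<^sup>2 - R\<close>\<close>

definition sphere_poly :: "real \<Rightarrow> 'n::finite cpoly" where
  "sphere_poly R =
     (\<Sum>i\<in>UNIV. Poly_Mapping.single (Poly_Mapping.single i 1, Poly_Mapping.single i 1) 1)
     - Poly_Mapping.single (0, 0) (complex_of_real R)"


section \<open>The polynomial optimization problem\<close>

text \<open>The inequality constraints are \<open>g 1, \<dots>, g m\<close> and the equality constraints \<open>h 1, \<dots>, h l\<close>.
  The real part is taken because a self-conjugate polynomial has real values; optimal values are
  extended reals, so that the infimum over the empty set is \<open>\<infinity>\<close>.\<close>

definition cpop_feasible ::
  "nat \<Rightarrow> (nat \<Rightarrow> 'n::finite cpoly) \<Rightarrow> nat \<Rightarrow> (nat \<Rightarrow> 'n cpoly) \<Rightarrow> (complex ^ 'n) set" where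
  "cpop_feasible m g l h =
     {z. (\<forall>i\<in>{1..m}. Re (cpoly_eval (g i) z) \<ge> 0) \<and> (\<forall>i\<in>{1..l}. cpoly_eval (h i) z = 0)}"

definition f_min ::
  "'n::finite cpoly \<Rightarrow> nat \<Rightarrow> (nat \<Rightarrow> 'n cpoly) \<Rightarrow> nat \<Rightarrow> (nat \<Rightarrow> 'n cpoly) \<Rightarrow> ereal" where
  "f_min f m g l h = (INF z\<in>cpop_feasible m g l h. ereal (Re (cpoly_eval f z)))"

definition cpop_optimal ::
  "'n::finite cpoly \<Rightarrow> nat \<Rightarrow> (nat \<Rightarrow> 'n cpoly) \<Rightarrow> nat \<Rightarrow> (nat \<Rightarrow> 'n cpoly) \<Rightarrow> complex ^ 'n \<Rightarrow> bool"
  where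
  "cpop_optimal f m g l h z \<longleftrightarrow>
     z \<in> cpop_feasible m g l h \<and> ereal (Re (cpoly_eval f z)) = f_min f m g l h"

definition d_min ::
  "'n::finite cpoly \<Rightarrow> nat \<Rightarrow> (nat \<Rightarrow> 'n cpoly) \<Rightarrow> nat \<Rightarrow> (nat \<Rightarrow> 'n cpoly) \<Rightarrow> nat" where
  "d_min f m g l h =
     Max ({cdeg f} \<union> (\<lambda>i. cdeg (g i)) ` {1..m} \<union> (\<lambda>i. cdeg (h i)) ` {1..l})"

definition d_K ::
  "nat \<Rightarrow> (nat \<Rightarrow> 'n::finite cpoly) \<Rightarrow> nat \<Rightarrow> (nat \<Rightarrow> 'n cpoly) \<Rightarrow> nat" where
  "d_K m g l h = Max ({2} \<union> (\<lambda>i. cdeg (g i)) ` {1..m} \<union> (\<lambda>i. cdeg (h i)) ` {1..l})"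


section \<open>Matrices indexed by a finite set\<close>

text \<open>A matrix with index set \<open>I\<close> is a function \<open>A\<close> of two indices of which only the values on
  \<open>I \<times> I\<close> matter.\<close>

definition psd_on :: "'a set \<Rightarrow> ('a \<Rightarrow> 'a \<Rightarrow> complex) \<Rightarrow> bool" where
  "psd_on I A \<longleftrightarrow>
     (\<forall>\<beta>\<in>I. \<forall>\<gamma>\<in>I. A \<gamma> \<beta> = cnj (A \<beta> \<gamma>)) \<and>
     (\<forall>v. 0 \<le> Re (\<Sum>\<beta>\<in>I. \<Sum>\<gamma>\<in>I. cnj (v \<beta>) * A \<beta> \<gamma> * v \<gamma>))"

definition zero_on :: "'a set \<Rightarrow> ('a \<Rightarrow> 'a \<Rightarrow> complex) \<Rightarrow> bool" where
  "zero_on I A \<longleftrightarrow> (\<forall>\<beta>\<in>I. \<forall>\<gamma>\<in>I. A \<beta> \<gamma> = 0)"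

definition fscale :: "complex \<Rightarrow> ('a \<Rightarrow> complex) \<Rightarrow> 'a \<Rightarrow> complex" where
  "fscale c v = (\<lambda>i. c * v i)"

lemma vector_space_fscale: "vector_space fscale"
  by unfold_locales (auto simp: fscale_def fun_eq_iff algebra_simps)

text \<open>The dimension of the complex span of the columns; a column is extended by 0 outside \<open>I\<close>.\<close>

definition rank_on :: "'a set \<Rightarrow> ('a \<Rightarrow> 'a \<Rightarrow> complex) \<Rightarrow> nat" where
  "rank_on I A = vector_space.dim fscale ((\<lambda>\<gamma> \<beta>. if \<beta> \<in> I then A \<beta> \<gamma> else 0) ` I)"


section \<open>Moment relaxations\<close>

type_synonym 'n mseq = "'n mindex \<Rightarrow> 'n mindex \<Rightarrow> complex"

definition pseudo_moment :: "'n mseq \<Rightarrow> bool" where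
  "pseudo_moment y \<longleftrightarrow> (\<forall>\<beta> \<gamma>. y \<beta> \<gamma> = cnj (y \<gamma> \<beta>))"

definition riesz :: "'n mseq \<Rightarrow> 'n cpoly \<Rightarrow> complex" where
  "riesz y p = (\<Sum>(\<beta>, \<gamma>)\<in>Poly_Mapping.keys p. Poly_Mapping.lookup p (\<beta>, \<gamma>) * y \<beta> \<gamma>)"

definition mindices :: "nat \<Rightarrow> 'n::finite mindex set" where
  "mindices s = {\<alpha>. mdeg \<alpha> \<le> s}"

text \<open>\<open>M\<^sub>s(y)\<close> and \<open>M\<^sub>s(g y)\<close> are \<open>moment_matrix y\<close> and \<open>localizing_matrix g y\<close> on the index set
  \<open>mindices s\<close>.\<close>

definition moment_matrix :: "'n mseq \<Rightarrow> 'n mindex \<Rightarrow> 'n mindex \<Rightarrow> complex" where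
  "moment_matrix y \<beta> \<gamma> = y \<beta> \<gamma>"

definition localizing_matrix :: "'n cpoly \<Rightarrow> 'n mseq \<Rightarrow> 'n mindex \<Rightarrow> 'n mindex \<Rightarrow> complex" where
  "localizing_matrix g y \<beta> \<gamma> =
     (\<Sum>(\<beta>', \<gamma>')\<in>Poly_Mapping.keys g. Poly_Mapping.lookup g (\<beta>', \<gamma>') * y (\<beta> + \<beta>') (\<gamma> + \<gamma>'))"

definition complex_relax_feasible ::
  "nat \<Rightarrow> (nat \<Rightarrow> 'n::finite cpoly) \<Rightarrow> nat \<Rightarrow> (nat \<Rightarrow> 'n cpoly) \<Rightarrow> nat \<Rightarrow> 'n mseq set" where
  "complex_relax_feasible m g l h r =
     {y. pseudo_moment y \<and>
         psd_on (mindices r) (moment_matrix y) \<and>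
         (\<forall>i\<in>{1..m}. psd_on (mindices (r - cdeg (g i))) (localizing_matrix (g i) y)) \<and>
         (\<forall>i\<in>{1..l}. zero_on (mindices (r - cdeg (h i))) (localizing_matrix (h i) y)) \<and>
         y 0 0 = 1}"

definition theta ::
  "'n::finite cpoly \<Rightarrow> nat \<Rightarrow> (nat \<Rightarrow> 'n cpoly) \<Rightarrow> nat \<Rightarrow> (nat \<Rightarrow> 'n cpoly) \<Rightarrow> nat \<Rightarrow> ereal" where
  "theta f m g l h r = (INF y\<in>complex_relax_feasible m g l h r. ereal (Re (riesz y f)))"

definition real_relax_feasible ::
  "nat \<Rightarrow> (nat \<Rightarrow> 'n::finite cpoly) \<Rightarrow> nat \<Rightarrow> (nat \<Rightarrow> 'n cpoly) \<Rightarrow> nat \<Rightarrow> 'n mseq set" where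
  "real_relax_feasible m g l h r =
     {y \<in> complex_relax_feasible m g l h r. \<forall>\<beta> \<gamma>. y \<beta> \<gamma> \<in> \<real>}"

definition real_relax_optimal ::
  "'n::finite cpoly \<Rightarrow> nat \<Rightarrow> (nat \<Rightarrow> 'n cpoly) \<Rightarrow> nat \<Rightarrow> (nat \<Rightarrow> 'n cpoly) \<Rightarrow> nat \<Rightarrow> 'n mseq \<Rightarrow> bool"
  where
  "real_relax_optimal f m g l h r y \<longleftrightarrow>
     y \<in> real_relax_feasible m g l h r \<and>
     ereal (Re (riesz y f)) = (INF y'\<in>real_relax_feasible m g l h r. ereal (Re (riesz y' f)))"

end

theory Submission
  imports Defs
begin

text \<open>
  A positive semidefinite moment matrix of rank two is a Gram matrix of vectors in \<open>\<complex>\<^sup>2\<close>, and the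
  sphere constraint makes the multiplications by the variables well-defined commuting operators
  \<open>T\<^sub>i\<close> on \<open>\<complex>\<^sup>2\<close> with \<open>\<Sum>\<^sub>i T\<^sub>i\<^sup>* T\<^sub>i = R\<close>. In an orthonormal basis adapted to a common eigenvector
  they are triangular with rows \<open>(a\<^sub>i, 0)\<close> and \<open>(b\<^sub>i, c\<^sub>i)\<close>. Commutation makes \<open>a - c\<close> a multiple \<open>\<lambda> b\<close>
  unless \<open>b = 0\<close>, while the sphere identity gives \<open>b\<close> orthogonal to \<open>c\<close> and
  \<open>|a|\<^sup>2 + |b|\<^sup>2 = |c|\<^sup>2 = R\<close>; together they force \<open>b = 0\<close>. So the \<open>T\<^sub>i\<close> are simultaneously
  diagonal and \<open>y\<close> is, up to order \<open>r\<close>, the moment sequence of a measure with two atoms. Testing the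
  localizing matrices against interpolating vectors supported on two monomials of degree at most
  \<open>r - d_K\<close> shows that both atoms are feasible. Taking real parts of a complex pseudo-moment
  sequence shows that the real and complex relaxations have the same value, so both atoms are
  optimal. If one of them is not real, then its conjugate is another optimal solution.
\<close>

section \<open>Pairs of linear equations\<close>

lemma linear_pair_zero:
  fixes x x' :: complex
  assumes "x * a + x' * b = 0" "x * c + x' * d = 0" "a * d \<noteq> c * b"
  shows "x = 0" "x' = 0"
proof -
  have "x * (a * d - c * b) = (x * a + x' * b) * d - (x * c + x' * d) * b"
    by (simp add: algebra_simps)
  then show "x = 0" using assms by simp
  have "x' * (a * d - c * b) = (x * c + x' * d) * a - (x * a + x' * b) * c"
    by (simp add: algebra_simps)
  then show "x' = 0" using assms by simp
qed

text \<open>The vectors \<open>(p1, q1)\<close> and \<open>(p2, q2)\<close> form a basis of the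
  plane, so a sesquilinear form vanishing on all pairs of them has zero matrix. The lemma serves
  both the sphere identity and the equality constraints.\<close>

lemma sesquilinear_pair_zero:
  fixes E F G H :: complex
  defines "\<Phi> \<equiv> \<lambda>s t s' t'. cnj s * (E * s' + F * t') + cnj t * (G * s' + H * t')"
  assumes det: "p1 * q2 \<noteq> p2 * q1"
    and "\<Phi> p1 q1 p1 q1 = 0" "\<Phi> p1 q1 p2 q2 = 0" "\<Phi> p2 q2 p1 q1 = 0" "\<Phi> p2 q2 p2 q2 = 0"
  shows "E = 0" "F = 0" "G = 0" "H = 0"
proof -
  have det': "cnj p1 * cnj q2 \<noteq> cnj p2 * cnj q1"
    using det by (metis complex_cnj_cancel_iff complex_cnj_mult)
  \<comment> \<open>For a fixed right argument the form is linear in the image vector, with the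
    conjugated basis as coefficients. Cramer's rule is then applied once on the left and once on the
    right.\<close>
  have *: "E * s' + F * t' = 0 \<and> G * s' + H * t' = 0"
    if "\<Phi> p1 q1 s' t' = 0" "\<Phi> p2 q2 s' t' = 0" for s' t'
  proof -
    have "(E * s' + F * t') * cnj p1 + (G * s' + H * t') * cnj q1 = 0"
      "(E * s' + F * t') * cnj p2 + (G * s' + H * t') * cnj q2 = 0"
      using that by (simp_all only: \<Phi>_def mult.commute)
    from linear_pair_zero[OF this det'] show ?thesis by blast
  qed
  note 1 = *[OF assms(3,5)] and 2 = *[OF assms(4,6)]
  show "E = 0" "F = 0"
    using linear_pair_zero[OF conjunct1[OF 1] conjunct1[OF 2] det] by blast+
  show "G = 0" "H = 0"
    using linear_pair_zero[OF conjunct2[OF 1] conjunct2[OF 2] det] by blast+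
qed

section \<open>Multi-indices and monomials\<close>

lemma mdeg_add [simp]: "mdeg (\<alpha> + \<beta>) = mdeg \<alpha> + mdeg \<beta>"
  by (simp add: mdeg_def lookup_add sum.distrib)

lemma mdeg_single [simp]: "mdeg (Poly_Mapping.single i k) = k"
  by (simp add: mdeg_def lookup_single when_def)

lemma mdeg_zero [simp]: "mdeg 0 = 0"
  by (simp add: mdeg_def)

lemma mdeg_eq_0_iff [simp]: "mdeg \<alpha> = 0 \<longleftrightarrow> \<alpha> = 0"
  by (auto simp: mdeg_def poly_mapping_eq_iff fun_eq_iff)

lemma mdeg_SucE:
  assumes "mdeg \<alpha> = Suc k"
  obtains i \<beta> where "\<alpha> = \<beta> + Poly_Mapping.single i 1" "mdeg \<beta> = k"
proof -
  obtain i where i: "Poly_Mapping.lookup \<alpha> i \<noteq> 0"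
    using assms by (metis mdeg_eq_0_iff nat.distinct(1) poly_mapping_eqI lookup_zero)
  define \<beta> where "\<beta> = \<alpha> - Poly_Mapping.single i 1"
  have eq: "\<alpha> = \<beta> + Poly_Mapping.single i 1"
    by (rule poly_mapping_eqI)
      (use i in \<open>auto simp: \<beta>_def lookup_add lookup_minus lookup_single when_def\<close>)
  then have "mdeg \<beta> = k"
    using assms by simp
  with eq that show thesis by blast
qed

lemma finite_mindices [simp]: "finite (mindices s)"
proof (rule finite_imageD)
  have "Poly_Mapping.lookup \<alpha> i \<le> s" if "\<alpha> \<in> mindices s" for \<alpha> :: "'a mindex" and i
    using that member_le_sum[of i UNIV "Poly_Mapping.lookup \<alpha>"]
    by (simp add: mindices_def mdeg_def)
  then have "Poly_Mapping.lookup ` mindices s \<subseteq> (UNIV :: 'a set) \<rightarrow>\<^sub>E {..s}"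
    by auto
  then show "finite (Poly_Mapping.lookup ` (mindices s :: 'a mindex set))"
    by (rule finite_subset) (simp add: finite_PiE)
  show "inj_on Poly_Mapping.lookup (mindices s)"
    by (metis inj_onI lookup_inject)
qed

lemma monom_eval_zero [simp]: "monom_eval z 0 = 1"
  by (simp add: monom_eval_def)

lemma monom_eval_add: "monom_eval z (\<alpha> + \<beta>) = monom_eval z \<alpha> * monom_eval z \<beta>"
  by (simp add: monom_eval_def lookup_add power_add prod.distrib)

lemma monom_eval_single [simp]: "monom_eval z (Poly_Mapping.single i 1) = z $ i"
  by (simp add: monom_eval_def lookup_single when_def if_distrib[of "\<lambda>k. _ ^ k"] cong: if_cong)

lemma monom_eval_vcnj: "monom_eval (vcnj z) \<alpha> = cnj (monom_eval z \<alpha>)"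
  by (simp add: monom_eval_def vcnj_def)

lemma real_point_iff_vcnj: "real_point z \<longleftrightarrow> vcnj z = z"
  by (simp add: real_point_def vcnj_def vec_eq_iff Reals_cnj_iff)

section \<open>Positive semidefinite matrices of rank two\<close>

lemma psd_on_two_points:
  assumes "finite I" "psd_on I A" "a \<in> I" "b \<in> I" "a \<noteq> b"
  shows "0 \<le> Re (cnj s * (A a a * s + A a b * t) + cnj t * (A b a * s + A b b * t))"
proof -
  define v where "v = (\<lambda>i. if i = a then s else if i = b then t else 0)"
  have row: "(\<Sum>i\<in>I. F i) = F a + F b"
    if "\<And>i. i \<noteq> a \<Longrightarrow> i \<noteq> b \<Longrightarrow> F i = 0" for F :: "'a \<Rightarrow> complex"
  proof -
    have "(\<Sum>i\<in>I. F i) = (\<Sum>i\<in>{a, b}. F i)"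
      by (rule sum.mono_neutral_right) (use assms that in auto)
    with assms show ?thesis by simp
  qed
  have "0 \<le> Re (\<Sum>i\<in>I. \<Sum>j\<in>I. cnj (v i) * A i j * v j)"
    using assms(2) unfolding psd_on_def by blast
  also have "(\<Sum>i\<in>I. \<Sum>j\<in>I. cnj (v i) * A i j * v j) =
      (\<Sum>i\<in>I. cnj (v i) * A i a * v a + cnj (v i) * A i b * v b)"
    by (rule sum.cong[OF refl], rule row) (simp add: v_def)
  also have "\<dots> = cnj (v a) * A a a * v a + cnj (v a) * A a b * v b +
      (cnj (v b) * A b a * v a + cnj (v b) * A b b * v b)"
    by (rule row) (simp add: v_def)
  finally show ?thesis
    using assms(5) by (simp add: v_def algebra_simps)
qed

text \<open>A basis of the columns of the \<open>J\<close> block stays independent when its columns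
  are extended to the rows in \<open>I\<close>. Since the rank does not grow, the two extended
  columns span the column space of the \<open>I\<close> block.\<close>

lemma rank_on_two_columns:
  assumes "J \<subseteq> I" "rank_on I A = 2" "rank_on J A = 2"
  obtains a b where "a \<in> J" "b \<in> J" "a \<noteq> b"
    "\<And>s t. (\<And>i. i \<in> J \<Longrightarrow> s * A i a + t * A i b = 0) \<Longrightarrow> s = 0 \<and> t = 0"
    "\<And>j. j \<in> I \<Longrightarrow> \<exists>s t. \<forall>i\<in>I. A i j = s * A i a + t * A i b"
proof -
  interpret vs: vector_space fscale by (rule vector_space_fscale)
  define col where "col = (\<lambda>K \<gamma> \<beta>. if \<beta> \<in> K then A \<beta> \<gamma> else (0::complex))"
  have rank: "rank_on K A = vs.dim (col K ` K)" for K
    by (simp only: rank_on_def col_def)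
  obtain B where B: "B \<subseteq> col J ` J" "vs.independent B" "card B = vs.dim (col J ` J)"
    by (rule vs.basis_exists[of "col J ` J"])
  have cardB: "card B = 2"
    using B(3) assms(3) rank by simp
  obtain X Y where XY: "B = {X, Y}" "X \<noteq> Y"
    using cardB by (auto simp: card_2_iff)
  then obtain a b where ab: "a \<in> J" "b \<in> J" "X = col J a" "Y = col J b"
    using B(1) by auto
  have ne: "a \<noteq> b" using XY ab by auto
  have indJ: "s = 0 \<and> t = 0" if eq: "\<And>i. i \<in> J \<Longrightarrow> s * A i a + t * A i b = 0" for s t
  proof -
    define u where "u = (\<lambda>Z. if Z = X then s else t)"
    have "(\<Sum>Z\<in>B. fscale (u Z) Z) = fscale s X + fscale t Y"
      using XY by (simp add: u_def)
    also have "\<dots> = 0"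
      unfolding fun_eq_iff using eq by (simp add: fscale_def ab col_def)
    finally have "\<forall>Z\<in>B. u Z = 0"
      using vs.independentD[OF B(2) _ subset_refl, of u] XY(1) by blast
    then show ?thesis using XY by (auto simp: u_def)
  qed
  obtain C where C: "vs.independent C" "col I ` I \<subseteq> vs.span C"
    "card C = vs.dim (col I ` I)"
    by (rule vs.basis_exists[of "col I ` I"])
  have cardC: "card C = 2"
    using C(3) assms(2) rank by simp
  have "finite C" using cardC by (rule_tac card_ge_0_finite) simp
  define D where "D = {col I a, col I b}"
  \<comment> \<open>Without this, the set \<open>D\<close> could collapse to one element and the
    cardinality count would fail.\<close>
  have neD: "col I a \<noteq> col I b"
  proof
    assume "col I a = col I b"
    then have "A i a = A i b" if "i \<in> I" for i
      using that by (metis col_def)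
    then show False using indJ[of 1 "-1"] assms(1) by auto
  qed
  have indD: "vs.independent D"
    unfolding vs.independent_explicit_module
  proof (intro allI impI)
    fix T u v
    assume T: "finite T" "T \<subseteq> D" "(\<Sum>v\<in>T. fscale (u v) v) = 0" "v \<in> T"
    define w where "w = (\<lambda>Z. if Z \<in> T then u Z else 0)"
    have "(\<Sum>Z\<in>D. fscale (w Z) Z) = (\<Sum>Z\<in>T. fscale (u Z) Z)"
      by (rule sum.mono_neutral_cong_right)
        (use T in \<open>auto simp: D_def w_def fscale_def fun_eq_iff\<close>)
    then have eq: "fscale (w (col I a)) (col I a) + fscale (w (col I b)) (col I b) = 0"
      using T neD by (simp add: D_def)
    have "w (col I a) * A i a + w (col I b) * A i b = 0" if "i \<in> I" for i
      using that fun_cong[OF eq, of i] by (simp add: fscale_def col_def)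
    then have "w (col I a) = 0 \<and> w (col I b) = 0"
      using indJ assms(1) by blast
    then show "u v = 0"
      using T by (auto simp: D_def w_def split: if_splits)
  qed
  have "\<exists>s t. \<forall>i\<in>I. A i j = s * A i a + t * A i b" if "j \<in> I" for j
  proof -
    have "col I j \<in> vs.span D"
    proof (rule ccontr)
      \<comment> \<open>A column outside the span would give three independent vectors in a space of
        dimension two.\<close>
      assume n: "col I j \<notin> vs.span D"
      then have "vs.independent (insert (col I j) D)"
        using indD by (rule vs.independent_insertI)
      moreover have "insert (col I j) D \<subseteq> vs.span C"
        using C(2) that ab assms(1) by (auto simp: D_def)
      ultimately have "card (insert (col I j) D) \<le> card C"
        using vs.independent_span_bound \<open>finite C\<close> by blast
      moreover have "col I j \<notin> D"
        using n vs.span_base by blast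
      ultimately show False
        using cardC neD by (simp add: D_def)
    qed
    then obtain s t where eq: "col I j = fscale s (col I a) + fscale t (col I b)"
      unfolding D_def vs.span_insert vs.span_empty by (auto simp: diff_eq_eq add.commute)
    have "A i j = s * A i a + t * A i b" if "i \<in> I" for i
      using that fun_cong[OF eq, of i] by (simp add: fscale_def col_def)
    then show ?thesis by blast
  qed
  with ab ne indJ that show thesis by blast
qed

text \<open>This is a Cholesky factorization of the 2 by 2 block on \<open>a\<close> and
  \<open>b\<close>, carried to all of \<open>I\<close> by the column relations. Having
  \<open>a\<close> and \<open>b\<close> in the smaller set \<open>J\<close> later leaves room for
  shifts and for the constraint polynomials.\<close>

lemma rank_two_psd_factorization:
  assumes "finite I" "J \<subseteq> I" "psd_on I A" "rank_on I A = 2" "rank_on J A = 2"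
  obtains p q a b where "a \<in> J" "b \<in> J" "p a * q b \<noteq> p b * q a"
    "\<And>i j. i \<in> I \<Longrightarrow> j \<in> I \<Longrightarrow> A i j = cnj (p i) * p j + cnj (q i) * q j"
proof (rule rank_on_two_columns[OF assms(2,4,5)])
  fix a b
  assume ab: "a \<in> J" "b \<in> J" "a \<noteq> b"
    and ind: "\<And>s t. (\<And>i. i \<in> J \<Longrightarrow> s * A i a + t * A i b = 0) \<Longrightarrow> s = 0 \<and> t = 0"
    and sp: "\<And>j. j \<in> I \<Longrightarrow> \<exists>s t. \<forall>i\<in>I. A i j = s * A i a + t * A i b"
  have abI: "a \<in> I" "b \<in> I" using ab assms(2) by auto
  have herm: "A j i = cnj (A i j)" if "i \<in> I" "j \<in> I" for i j
    using assms(3) that unfolding psd_on_def by blast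
  define X Y Z where "X = Re (A a a)" and "Y = A a b" and "Z = Re (A b b)"
  have "A a a \<in> \<real>" "A b b \<in> \<real>"
    using herm[OF abI(1) abI(1)] herm[OF abI(2) abI(2)] by (simp_all only: Reals_cnj_iff)
  then have A: "A a a = of_real X" "A b b = of_real Z" "A a b = Y" "A b a = cnj Y"
    using herm[OF abI] by (simp_all add: X_def Y_def Z_def of_real_Re)
  define D where "D = X * Z - (cmod Y)\<^sup>2"
  have YY: "cnj Y * Y = of_real ((cmod Y)\<^sup>2)" "Y * cnj Y = of_real ((cmod Y)\<^sup>2)"
    by (simp_all only: complex_norm_square mult.commute)
  \<comment> \<open>The 2 by 2 block is nonsingular: by Hermitian symmetry each row of the two
    columns is a combination of rows \<open>a\<close> and \<open>b\<close>, so a relation on these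
    two rows holds on all rows in \<open>J\<close>.\<close>
  have null: "s = 0 \<and> t = 0" if st: "s * X + t * Y = 0" "s * cnj Y + t * Z = 0" for s t :: complex
  proof (rule ind)
    fix i assume "i \<in> J"
    then have i: "i \<in> I" using assms(2) by blast
    obtain u v where uv: "\<forall>k\<in>I. A k i = u * A k a + v * A k b" using sp[OF i] by blast
    have "A i a = cnj u * X + cnj v * cnj Y" "A i b = cnj u * Y + cnj v * Z"
      using uv abI herm[OF abI(1) i] herm[OF abI(2) i] by (simp_all add: A)
    then have "s * A i a + t * A i b = cnj u * (s * X + t * Y) + cnj v * (s * cnj Y + t * Z)"
      by (simp add: algebra_simps)
    then show "s * A i a + t * A i b = 0" by (simp add: st)
  qed
  have pos: "0 \<le> Re (cnj s * (X * s + Y * t) + cnj t * (cnj Y * s + Z * t))" for s t :: complex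
    using psd_on_two_points[OF assms(1,3) abI ab(3), of s t] by (simp only: A)
  have D0: "D \<noteq> 0"
  proof
    assume "D = 0"
    then have D': "complex_of_real (X * Z) = of_real ((cmod Y)\<^sup>2)" by (simp add: D_def)
    \<comment> \<open>A singular block would have \<open>(Y, - X)\<close> in its kernel.\<close>
    have "Y * X + (-X) * Y = 0" by simp
    moreover have "Y * cnj Y + (- of_real X) * of_real Z = 0"
      using D' by (simp add: YY)
    ultimately have "Y = 0 \<and> - complex_of_real X = 0" by (intro null) simp_all
    then show False using null[of 1 0] by simp
  qed
  have X: "X > 0"
  proof (rule ccontr)
    assume "\<not> X > 0"
    moreover have "X \<ge> 0" using pos[of 1 0] by simp
    ultimately have X0: "X = 0" by simp
    then have Y0: "(cmod Y)\<^sup>2 > 0" using D0 by (simp add: D_def)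
    \<comment> \<open>This \<open>k\<close> makes the quadratic form equal to -1 at the vector
      \<open>(- k * Y, 1)\<close>.\<close>
    define k where "k = (Z + 1) / (2 * (cmod Y)\<^sup>2)"
    have "0 \<le> Re (- (of_real k * (cnj Y * Y)) + (- (of_real k * (cnj Y * Y)) + of_real Z))"
      using pos[of "- of_real k * Y" 1] by (simp add: X0 algebra_simps)
    then have "0 \<le> Z - 2 * k * (cmod Y)\<^sup>2"
      unfolding YY of_real_mult[symmetric] by simp
    moreover have "2 * k * (cmod Y)\<^sup>2 = Z + 1"
      using Y0 by (simp add: k_def)
    ultimately show False by simp
  qed
  have D: "D > 0"
  proof -
    \<comment> \<open>The quadratic form at \<open>(- Y, X)\<close> equals
      \<open>X * D\<close>.\<close>
    have "0 \<le> Re (of_real X * (- (cnj Y * Y) + of_real Z * of_real X))"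
      using pos[of "- Y" "of_real X"] by (simp add: algebra_simps)
    also have "of_real X * (- (cnj Y * Y) + of_real Z * of_real X) = complex_of_real (X * D)"
      unfolding YY by (simp add: D_def algebra_simps)
    finally have "0 \<le> X * D" by simp
    with X D0 show ?thesis by (simp add: zero_le_mult_iff)
  qed
  \<comment> \<open>These are the two rows of the Cholesky factor: row \<open>a\<close> divided by
    the root of its pivot, and row \<open>b\<close> after elimination divided by the root of the
    Schur complement \<open>D / X\<close>.\<close>
  define p where "p = (\<lambda>i. A a i / sqrt X)"
  define q where "q = (\<lambda>i. (A b i - cnj Y / X * A a i) / sqrt (D / X))"
  have sqX: "complex_of_real (sqrt X) * of_real (sqrt X) = of_real X"
    unfolding of_real_mult[symmetric] using X by simp
  have sqD: "complex_of_real (sqrt (D / X)) * of_real (sqrt (D / X)) = of_real D / of_real X"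
    unfolding of_real_mult[symmetric] of_real_divide[symmetric] using X D by simp
  have pp: "cnj (p i) * p j = A i a * A a j / X" if "i \<in> I" for i j
    using herm[OF abI(1) that] by (simp add: p_def sqX)
  have qq: "cnj (q i) * q j =
      (A i b - Y / X * A i a) * (A b j - cnj Y / X * A a j) / (of_real D / of_real X)"
    if "i \<in> I" for i j
    using herm[OF abI(1) that] herm[OF abI(2) that] by (simp add: q_def sqD)
  have XD: "complex_of_real X \<noteq> 0" "complex_of_real D \<noteq> 0" using X D by auto
  have Dc: "of_real Z - cnj Y / X * Y = of_real D / of_real X"
    using XD by (simp add: D_def field_simps YY)
  have colb: "A i b = cnj (p i) * p b + cnj (q i) * q b" if "i \<in> I" for i
    unfolding pp[OF that] qq[OF that] A Dc using XD by (simp add: field_simps)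
  have cola: "A i a = cnj (p i) * p a + cnj (q i) * q a" if "i \<in> I" for i
    unfolding pp[OF that] qq[OF that] A using XD by simp
  have "A i j = cnj (p i) * p j + cnj (q i) * q j" if ij: "i \<in> I" "j \<in> I" for i j
  proof -
    \<comment> \<open>As functions of the column index, \<open>p\<close> and \<open>q\<close> obey
      the same linear relations as the columns of \<open>A\<close>, so the identity extends from the
      columns \<open>a\<close> and \<open>b\<close> to all columns.\<close>
    obtain s t where st: "\<forall>k\<in>I. A k j = s * A k a + t * A k b" using sp[OF ij(2)] by blast
    have "p j = s * p a + t * p b" "q j = s * q a + t * q b"
      using st abI by (simp_all add: p_def q_def add_divide_distrib diff_divide_distrib algebra_simps)
    then have "cnj (p i) * p j + cnj (q i) * q j =
        s * (cnj (p i) * p a + cnj (q i) * q a) + t * (cnj (p i) * p b + cnj (q i) * q b)"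
      by (simp add: algebra_simps)
    also have "\<dots> = s * A i a + t * A i b" using cola[OF ij(1)] colb[OF ij(1)] by simp
    finally show ?thesis using st ij by simp
  qed
  moreover have "p a * q b \<noteq> p b * q a"
  proof -
    have "q a = 0" using XD by (simp add: q_def A)
    moreover have "p a \<noteq> 0" using X by (simp add: p_def A)
    moreover have "q b \<noteq> 0" unfolding q_def A Dc using X D by simp
    ultimately show ?thesis by simp
  qed
  ultimately show thesis using that ab by blast
qed

section \<open>Shift operators on the sphere\<close>

text \<open>By the sphere identity, the squared norms of all shifts of a combination of the vectors
  \<open>(p \<gamma>, q \<gamma>)\<close> add up to \<open>R\<close> times the squared norm of the
  combination itself. Hence shifting respects linear relations, which makes multiplication by a
  variable well defined on the plane.\<close>

lemma shift_combination_zero: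
  fixes p q :: "'n::finite mindex \<Rightarrow> complex" and R :: complex
  assumes sph: "\<And>\<beta> \<gamma>. mdeg \<beta> < r \<Longrightarrow> mdeg \<gamma> < r \<Longrightarrow>
      (\<Sum>i\<in>UNIV. cnj (p (\<beta> + Poly_Mapping.single i 1)) * p (\<gamma> + Poly_Mapping.single i 1) +
        cnj (q (\<beta> + Poly_Mapping.single i 1)) * q (\<gamma> + Poly_Mapping.single i 1)) =
      R * (cnj (p \<beta>) * p \<gamma> + cnj (q \<beta>) * q \<gamma>)"
    and deg: "\<And>k. k \<in> K \<Longrightarrow> mdeg (\<kappa> k) < r"
    and 0: "(\<Sum>k\<in>K. x k * p (\<kappa> k)) = 0" "(\<Sum>k\<in>K. x k * q (\<kappa> k)) = 0"
  shows "(\<Sum>k\<in>K. x k * p (\<kappa> k + Poly_Mapping.single i 1)) = 0"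
    and "(\<Sum>k\<in>K. x k * q (\<kappa> k + Poly_Mapping.single i 1)) = 0"
proof -
  define P where "P = (\<lambda>i. \<Sum>k\<in>K. x k * p (\<kappa> k + Poly_Mapping.single i 1))"
  define Q where "Q = (\<lambda>i. \<Sum>k\<in>K. x k * q (\<kappa> k + Poly_Mapping.single i 1))"
  have prod: "cnj (\<Sum>k\<in>K. x k * u k) * (\<Sum>k\<in>K. x k * u k) =
      (\<Sum>k\<in>K. \<Sum>k'\<in>K. cnj (x k) * x k' * (cnj (u k) * u k'))" for u
    by (simp add: cnj_sum sum_product mult.assoc mult.left_commute)
  \<comment> \<open>The squared norms are expanded into double sums over \<open>K\<close>, so that
    the sphere identity can be applied to each pair of indices.\<close>
  have "(\<Sum>i\<in>UNIV. cnj (P i) * P i + cnj (Q i) * Q i) =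
      (\<Sum>i\<in>UNIV. \<Sum>k\<in>K. \<Sum>k'\<in>K. cnj (x k) * x k' *
        (cnj (p (\<kappa> k + Poly_Mapping.single i 1)) * p (\<kappa> k' + Poly_Mapping.single i 1) +
         cnj (q (\<kappa> k + Poly_Mapping.single i 1)) * q (\<kappa> k' + Poly_Mapping.single i 1)))"
    unfolding P_def Q_def prod by (simp only: sum.distrib[symmetric] distrib_left)
  also have "\<dots> = (\<Sum>k\<in>K. \<Sum>i\<in>UNIV. \<Sum>k'\<in>K. cnj (x k) * x k' *
        (cnj (p (\<kappa> k + Poly_Mapping.single i 1)) * p (\<kappa> k' + Poly_Mapping.single i 1) +
         cnj (q (\<kappa> k + Poly_Mapping.single i 1)) * q (\<kappa> k' + Poly_Mapping.single i 1)))"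
    by (rule sum.swap)
  also have "\<dots> = (\<Sum>k\<in>K. \<Sum>k'\<in>K. \<Sum>i\<in>UNIV. cnj (x k) * x k' *
        (cnj (p (\<kappa> k + Poly_Mapping.single i 1)) * p (\<kappa> k' + Poly_Mapping.single i 1) +
         cnj (q (\<kappa> k + Poly_Mapping.single i 1)) * q (\<kappa> k' + Poly_Mapping.single i 1)))"
    by (rule sum.cong[OF refl], rule sum.swap)
  also have "\<dots> = (\<Sum>k\<in>K. \<Sum>k'\<in>K. cnj (x k) * x k' *
      (R * (cnj (p (\<kappa> k)) * p (\<kappa> k') + cnj (q (\<kappa> k)) * q (\<kappa> k'))))"
    unfolding sum_distrib_left[symmetric] by (intro sum.cong refl) (simp only: sph deg)
  also have "\<dots> = R * ((\<Sum>k\<in>K. \<Sum>k'\<in>K. cnj (x k) * x k' * (cnj (p (\<kappa> k)) * p (\<kappa> k'))) +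
      (\<Sum>k\<in>K. \<Sum>k'\<in>K. cnj (x k) * x k' * (cnj (q (\<kappa> k)) * q (\<kappa> k'))))"
    by (simp add: sum_distrib_left sum.distrib algebra_simps)
  also have "\<dots> = 0"
    unfolding prod[symmetric] by (simp add: 0)
  finally have "(\<Sum>i\<in>UNIV. (cmod (P i))\<^sup>2 + (cmod (Q i))\<^sup>2) = 0"
    unfolding of_real_eq_iff[where 'a = complex, symmetric]
    by (simp add: complex_norm_square mult.commute del: of_real_power)
  then have "(cmod (P i))\<^sup>2 + (cmod (Q i))\<^sup>2 = 0"
    by (subst (asm) sum_nonneg_eq_0_iff) auto
  then show "(\<Sum>k\<in>K. x k * p (\<kappa> k + Poly_Mapping.single i 1)) = 0"
    "(\<Sum>k\<in>K. x k * q (\<kappa> k + Poly_Mapping.single i 1)) = 0"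
    by (simp_all add: P_def Q_def sum_power2_eq_zero_iff)
qed

text \<open>The vectors at \<open>a\<close> and \<open>b\<close> form a basis, and relations survive
  shifting. The images of this basis therefore determine each shift as a 2 by 2 matrix.\<close>

lemma shift_matrix:
  fixes p q :: "'n::finite mindex \<Rightarrow> complex" and R :: complex
  assumes sph: "\<And>\<beta> \<gamma>. mdeg \<beta> < r \<Longrightarrow> mdeg \<gamma> < r \<Longrightarrow>
      (\<Sum>i\<in>UNIV. cnj (p (\<beta> + Poly_Mapping.single i 1)) * p (\<gamma> + Poly_Mapping.single i 1) +
        cnj (q (\<beta> + Poly_Mapping.single i 1)) * q (\<gamma> + Poly_Mapping.single i 1)) =
      R * (cnj (p \<beta>) * p \<gamma> + cnj (q \<beta>) * q \<gamma>)"
    and ab: "mdeg a < r" "mdeg b < r" "p a * q b \<noteq> p b * q a"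
  obtains A B C D where
    "\<And>i \<gamma>. mdeg \<gamma> < r \<Longrightarrow> p (\<gamma> + Poly_Mapping.single i 1) = A i * p \<gamma> + B i * q \<gamma>"
    "\<And>i \<gamma>. mdeg \<gamma> < r \<Longrightarrow> q (\<gamma> + Poly_Mapping.single i 1) = C i * p \<gamma> + D i * q \<gamma>"
proof -
  define \<Delta> where "\<Delta> = p a * q b - p b * q a"
  have \<Delta>: "\<Delta> \<noteq> 0" using ab by (simp add: \<Delta>_def)
  define A B where "A = (\<lambda>w i. (w (a + Poly_Mapping.single i 1) * q b -
      w (b + Poly_Mapping.single i 1) * q a) / \<Delta>)"
    and "B = (\<lambda>w i. (p a * w (b + Poly_Mapping.single i 1) -
      p b * w (a + Poly_Mapping.single i 1)) / \<Delta>)"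
    for w :: "'n mindex \<Rightarrow> complex" and i
  have shift: "w (\<gamma> + Poly_Mapping.single i 1) = A w i * p \<gamma> + B w i * q \<gamma>"
    if \<gamma>: "mdeg \<gamma> < r" and w: "w = p \<or> w = q" for w i \<gamma>
  proof -
    define \<kappa> where "\<kappa> = (\<lambda>k::nat. if k = 0 then \<gamma> else if k = 1 then a else b)"
    \<comment> \<open>The coefficients are, up to sign, the 2 by 2 minors of the matrix whose
      columns are the vectors at \<open>\<gamma>\<close>, \<open>a\<close> and \<open>b\<close>; the
      combination then vanishes identically.\<close>
    define x where "x = (\<lambda>k::nat. if k = 0 then \<Delta> else if k = 1 then p b * q \<gamma> - p \<gamma> * q b
      else p \<gamma> * q a - p a * q \<gamma>)"
    have three: "(\<Sum>k<3. F k) = F 0 + F 1 + F 2" for F :: "nat \<Rightarrow> complex"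
      by (simp add: eval_nat_numeral)
    have "mdeg (\<kappa> k) < r" for k
      using \<gamma> ab by (simp add: \<kappa>_def)
    moreover have "(\<Sum>k<3. x k * p (\<kappa> k)) = 0" "(\<Sum>k<3. x k * q (\<kappa> k)) = 0"
      by (simp_all add: three x_def \<kappa>_def \<Delta>_def algebra_simps)
    ultimately have "(\<Sum>k<3. x k * w (\<kappa> k + Poly_Mapping.single i 1)) = 0"
      using w shift_combination_zero[OF sph, where K = "{..<3}" and \<kappa> = \<kappa> and x = x and i = i]
      by blast
    then have "\<Delta> * w (\<gamma> + Poly_Mapping.single i 1) =
        (p \<gamma> * q b - p b * q \<gamma>) * w (a + Poly_Mapping.single i 1) +
        (p a * q \<gamma> - p \<gamma> * q a) * w (b + Poly_Mapping.single i 1)"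
      by (simp add: three x_def \<kappa>_def algebra_simps)
    then have "w (\<gamma> + Poly_Mapping.single i 1) =
        ((p \<gamma> * q b - p b * q \<gamma>) * w (a + Poly_Mapping.single i 1) +
        (p a * q \<gamma> - p \<gamma> * q a) * w (b + Poly_Mapping.single i 1)) / \<Delta>"
      using \<Delta> by (simp add: field_simps)
    also have "\<dots> = A w i * p \<gamma> + B w i * q \<gamma>"
      by (simp add: A_def B_def add_divide_distrib diff_divide_distrib algebra_simps)
    finally show ?thesis .
  qed
  show thesis
    by (rule that[of "A p" "B p" "A q" "B q"]) (rule shift; simp)+
qed

section \<open>Simultaneous diagonalization of the shifts\<close>

lemma complex_quadratic_root:
  fixes a b c :: complex
  assumes "a \<noteq> 0"
  obtains z where "a * z\<^sup>2 + b * z + c = 0"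
proof -
  define w where "w = csqrt (b\<^sup>2 - 4 * a * c)"
  define z where "z = (w - b) / (2 * a)"
  have "2 * a * z + b = w"
    using assms by (simp add: z_def)
  then have "(2 * a * z + b)\<^sup>2 = b\<^sup>2 - 4 * a * c"
    by (simp add: w_def)
  then have "4 * a * (a * z\<^sup>2 + b * z + c) = 0"
    by (simp add: power2_eq_square algebra_simps)
  with assms that show thesis by simp
qed

text \<open>The hypotheses say that the first rows of the commutators of the matrices
  \<open>[[A i, B i], [C i, D i]]\<close> vanish; this already suffices.\<close>

lemma common_left_eigenvector:
  fixes A B C D :: "'i \<Rightarrow> complex"
  assumes BC: "\<And>i j. B i * C j = B j * C i"
    and AB: "\<And>i j. (A i - D i) * B j = (A j - D j) * B i"
  obtains s t a where "cnj s * s + cnj t * t = 1"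
    "\<And>i. s * A i + t * C i = a i * s" "\<And>i. s * B i + t * D i = a i * t"
proof (cases "\<forall>i. B i = 0")
  case True
  then show thesis using that[of 1 0 A] by simp
next
  case False
  then obtain k where k: "B k \<noteq> 0" by blast
  \<comment> \<open>The row vector \<open>(z, 1)\<close> is a left eigenvector of the
    \<open>k\<close>-th matrix exactly when \<open>z\<close> solves this quadratic.\<close>
  obtain z where z: "B k * z\<^sup>2 + (D k - A k) * z + (- C k) = 0"
    using k by (rule complex_quadratic_root)
  \<comment> \<open>The commutation relations make the quadratics of all indices proportional, so
    the root for \<open>k\<close> works for every \<open>i\<close>.\<close>
  have zi: "B i * z\<^sup>2 + (D i - A i) * z - C i = 0" for i
  proof -
    have "B k * (B i * z\<^sup>2 + (D i - A i) * z - C i) =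
        B i * (B k * z\<^sup>2 + (D k - A k) * z + (- C k)) +
        ((A k - D k) * B i - (A i - D i) * B k) * z + (B i * C k - B k * C i)"
      by (simp add: algebra_simps)
    also have "\<dots> = 0" using z BC[of i k] AB[of i k] by simp
    finally show ?thesis using k by simp
  qed
  define n where "n = sqrt (1 + (cmod z)\<^sup>2)"
  have n: "n > 0" "n\<^sup>2 = 1 + (cmod z)\<^sup>2"
    by (simp_all add: n_def add_pos_nonneg)
  show thesis
  \<comment> \<open>The vector \<open>(z, 1)\<close> is normalized by \<open>n\<close>; its last
    entry reveals the eigenvalue.\<close>
  proof (rule that[of "z / n" "1 / n" "\<lambda>i. z * B i + D i"])
    have "cnj (z / n) * (z / n) + cnj (1 / n) * (1 / n) =
        (complex_of_real ((cmod z)\<^sup>2) + 1) / of_real (n\<^sup>2)"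
      unfolding complex_norm_square
      by (simp add: power2_eq_square add_divide_distrib mult.commute)
    also have "complex_of_real ((cmod z)\<^sup>2) + 1 = of_real (n\<^sup>2)"
      by (simp add: n)
    finally show "cnj (z / n) * (z / n) + cnj (1 / n) * (1 / n) = 1"
      using n(1) by simp
    show "z / n * A i + 1 / n * C i = (z * B i + D i) * (z / n)" for i
      using zi[of i] n(1) by (simp add: field_simps power2_eq_square)
    show "z / n * B i + 1 / n * D i = (z * B i + D i) * (1 / n)" for i
      by (simp add: add_divide_distrib)
  qed
qed

text \<open>A unitary change of coordinates keeps the Gram values and makes the shifts lower
  triangular; commutation and the sphere identity then kill the remaining off-diagonal entries. The
  strict bounds on \<open>a\<close> and \<open>b\<close> allow two successive shifts from the basis
  vectors.\<close>

lemma spherical_pair_diagonal: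
  fixes p q :: "'n::finite mindex \<Rightarrow> complex" and R :: complex
  assumes sph: "\<And>\<beta> \<gamma>. mdeg \<beta> < r \<Longrightarrow> mdeg \<gamma> < r \<Longrightarrow>
      (\<Sum>i\<in>UNIV. cnj (p (\<beta> + Poly_Mapping.single i 1)) * p (\<gamma> + Poly_Mapping.single i 1) +
        cnj (q (\<beta> + Poly_Mapping.single i 1)) * q (\<gamma> + Poly_Mapping.single i 1)) =
      R * (cnj (p \<beta>) * p \<gamma> + cnj (q \<beta>) * q \<gamma>)"
    and ab: "Suc (mdeg a) < r" "Suc (mdeg b) < r" "p a * q b \<noteq> p b * q a"
  obtains p' q' u v where
    "\<And>\<beta> \<gamma>. cnj (p \<beta>) * p \<gamma> + cnj (q \<beta>) * q \<gamma> = cnj (p' \<beta>) * p' \<gamma> + cnj (q' \<beta>) * q' \<gamma>"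
    "p' a * q' b \<noteq> p' b * q' a"
    "\<And>i \<gamma>. mdeg \<gamma> < r \<Longrightarrow> p' (\<gamma> + Poly_Mapping.single i 1) = u i * p' \<gamma>"
    "\<And>i \<gamma>. mdeg \<gamma> < r \<Longrightarrow> q' (\<gamma> + Poly_Mapping.single i 1) = v i * q' \<gamma>"
proof -
  define e :: "'n \<Rightarrow> 'n mindex" where "e = (\<lambda>i. Poly_Mapping.single i 1)"
  have mdeg_e: "mdeg (e i) = 1" for i by (simp add: e_def)
  have ab': "mdeg a < r" "mdeg b < r" using ab by auto
  obtain A B C D where
    shp: "\<And>i \<gamma>. mdeg \<gamma> < r \<Longrightarrow> p (\<gamma> + e i) = A i * p \<gamma> + B i * q \<gamma>" and
    shq: "\<And>i \<gamma>. mdeg \<gamma> < r \<Longrightarrow> q (\<gamma> + e i) = C i * p \<gamma> + D i * q \<gamma>"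
    using shift_matrix[OF sph ab' ab(3)] unfolding e_def by metis
  have swap: "\<gamma> + e j + e i = \<gamma> + e i + e j" for \<gamma> :: "'n mindex" and i j
    by (simp add: ac_simps)
  \<comment> \<open>Shifting by \<open>i\<close> and \<open>j\<close> in either order gives the same
    first coordinate.\<close>
  have c1: "(B i * C j - B j * C i) * p \<gamma> + ((A i - D i) * B j - (A j - D j) * B i) * q \<gamma> = 0"
    if \<gamma>: "Suc (mdeg \<gamma>) < r" for \<gamma> i j
  proof -
    have "p (\<gamma> + e j + e i) = A i * (A j * p \<gamma> + B j * q \<gamma>) + B i * (C j * p \<gamma> + D j * q \<gamma>)" for i j
      using \<gamma> by (simp add: shp shq mdeg_e)
    from this[of j i] this[of i j] swap[of \<gamma> j i] show ?thesis
      by (simp add: algebra_simps)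
  qed
  have comm: "B i * C j = B j * C i" "(A i - D i) * B j = (A j - D j) * B i" for i j
    using linear_pair_zero[OF c1[OF ab(1), of i j] c1[OF ab(2), of i j] ab(3)] by simp_all
  obtain s t l where st: "cnj s * s + cnj t * t = 1"
    and l: "\<And>i. s * A i + t * C i = l i * s" "\<And>i. s * B i + t * D i = l i * t"
    by (rule common_left_eigenvector[OF comm]) (rule that)
  \<comment> \<open>These are coordinates under the unitary matrix with rows \<open>(s, t)\<close>
    and \<open>(- cnj t, cnj s)\<close>. The first row is the common left eigenvector, so
    \<open>P\<close> is merely scaled by each shift.\<close>
  define P Q where "P = (\<lambda>\<gamma>. s * p \<gamma> + t * q \<gamma>)" and "Q = (\<lambda>\<gamma>. cnj s * q \<gamma> - cnj t * p \<gamma>)"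
  have inner: "cnj (P \<beta>) * P \<gamma> + cnj (Q \<beta>) * Q \<gamma> = cnj (p \<beta>) * p \<gamma> + cnj (q \<beta>) * q \<gamma>" for \<beta> \<gamma>
  proof -
    have "cnj (P \<beta>) * P \<gamma> + cnj (Q \<beta>) * Q \<gamma> =
        (cnj s * s + cnj t * t) * (cnj (p \<beta>) * p \<gamma> + cnj (q \<beta>) * q \<gamma>)"
      by (simp add: P_def Q_def algebra_simps)
    then show ?thesis by (simp add: st)
  qed
  have det: "P a * Q b \<noteq> P b * Q a"
  proof -
    have "P a * Q b - P b * Q a = (cnj s * s + cnj t * t) * (p a * q b - p b * q a)"
      by (simp add: P_def Q_def algebra_simps)
    then show ?thesis using ab(3) by (auto simp: st)
  qed
  have shP: "P (\<gamma> + e i) = l i * P \<gamma>" if "mdeg \<gamma> < r" for \<gamma> i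
  proof -
    have "P (\<gamma> + e i) = (s * A i + t * C i) * p \<gamma> + (s * B i + t * D i) * q \<gamma>"
      using that by (simp add: P_def shp shq algebra_simps)
    then show ?thesis by (simp add: l P_def algebra_simps)
  qed
  have sph': "(\<Sum>i\<in>UNIV. cnj (P (\<beta> + e i)) * P (\<gamma> + e i) + cnj (Q (\<beta> + e i)) * Q (\<gamma> + e i)) =
      R * (cnj (P \<beta>) * P \<gamma> + cnj (Q \<beta>) * Q \<gamma>)" if "mdeg \<beta> < r" "mdeg \<gamma> < r" for \<beta> \<gamma>
    using sph[OF that] by (simp only: inner e_def)
  obtain K M where shQ: "\<And>i \<gamma>. mdeg \<gamma> < r \<Longrightarrow> Q (\<gamma> + e i) = K i * P \<gamma> + M i * Q \<gamma>"
    using shift_matrix[OF sph'[unfolded e_def] ab' det] unfolding e_def by metis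
  \<comment> \<open>Commutation is now read off the second coordinate; the diagonal products cancel,
    which leaves the coefficient 0 in front of \<open>Q \<gamma>\<close>.\<close>
  have c2: "((l i - M i) * K j - (l j - M j) * K i) * P \<gamma> + 0 * Q \<gamma> = 0"
    if \<gamma>: "Suc (mdeg \<gamma>) < r" for \<gamma> i j
  proof -
    have "Q (\<gamma> + e j + e i) = K i * (l j * P \<gamma>) + M i * (K j * P \<gamma> + M j * Q \<gamma>)" for i j
      using \<gamma> by (simp add: shP shQ mdeg_e)
    from this[of j i] this[of i j] swap[of \<gamma> j i] show ?thesis
      by (simp add: algebra_simps)
  qed
  have comm': "(l i - M i) * K j = (l j - M j) * K i" for i j
    using linear_pair_zero(1)[OF c2[OF ab(1), of i j] c2[OF ab(2), of i j] det] by simp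
  \<comment> \<open>In these coordinates the sphere identity says that a fixed 2 by 2 matrix gives a
    form vanishing on a basis. Its entries express that \<open>K\<close> is orthogonal to
    \<open>M\<close>, that \<open>M\<close> has squared norm \<open>R\<close>, and that the squared
    norms of \<open>l\<close> and \<open>K\<close> add up to \<open>R\<close>.\<close>
  have form: "cnj (P \<beta>) * (((\<Sum>i\<in>UNIV. cnj (l i) * l i) + (\<Sum>i\<in>UNIV. cnj (K i) * K i) - R) * P \<gamma> +
        (\<Sum>i\<in>UNIV. cnj (K i) * M i) * Q \<gamma>) +
      cnj (Q \<beta>) * ((\<Sum>i\<in>UNIV. cnj (M i) * K i) * P \<gamma> +
        ((\<Sum>i\<in>UNIV. cnj (M i) * M i) - R) * Q \<gamma>) = 0"
    if "mdeg \<beta> < r" "mdeg \<gamma> < r" for \<beta> \<gamma>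
  proof -
    have "R * (cnj (P \<beta>) * P \<gamma> + cnj (Q \<beta>) * Q \<gamma>) =
        (\<Sum>i\<in>UNIV. cnj (l i) * l i * (cnj (P \<beta>) * P \<gamma>) + (cnj (K i) * K i * (cnj (P \<beta>) * P \<gamma>) +
          (cnj (K i) * M i * (cnj (P \<beta>) * Q \<gamma>) + (cnj (M i) * K i * (cnj (Q \<beta>) * P \<gamma>) +
          cnj (M i) * M i * (cnj (Q \<beta>) * Q \<gamma>)))))"
      unfolding sph'[OF that, symmetric] shP[OF that(1)] shP[OF that(2)] shQ[OF that(1)] shQ[OF that(2)]
      by (rule sum.cong[OF refl]) (simp add: algebra_simps)
    then show ?thesis
      by (simp only: sum.distrib sum_distrib_right[symmetric]) (simp add: algebra_simps)
  qed
  note zero = sesquilinear_pair_zero[OF det form[OF ab'(1,1)] form[OF ab'(1,2)]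
      form[OF ab'(2,1)] form[OF ab'(2,2)]]
  have K0: "K k = 0" for k
  proof (rule ccontr)
    assume k: "K k \<noteq> 0"
    define \<rho> where "\<rho> = (l k - M k) / K k"
    have li: "l i = M i + \<rho> * K i" for i
      using comm'[of i k] k by (simp add: \<rho>_def field_simps)
    define S where "S = (\<Sum>i\<in>UNIV. (cmod (K i))\<^sup>2)"
    have S: "(\<Sum>i\<in>UNIV. cnj (K i) * K i) = of_real S"
      by (simp add: S_def complex_norm_square mult.commute del: of_real_power)
    \<comment> \<open>Since \<open>l = M + \<rho> * K\<close> with \<open>K\<close> orthogonal to
      \<open>M\<close>, Pythagoras gives \<open>l\<close> the squared norm \<open>R\<close> plus a
      nonnegative multiple of \<open>S\<close>. The first entry of the form then forces
      \<open>S = 0\<close>.\<close>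
    have "(\<Sum>i\<in>UNIV. cnj (l i) * l i) = (\<Sum>i\<in>UNIV. cnj (M i) * M i) +
        (\<rho> * (\<Sum>i\<in>UNIV. cnj (M i) * K i) + (cnj \<rho> * (\<Sum>i\<in>UNIV. cnj (K i) * M i) +
         cnj \<rho> * \<rho> * (\<Sum>i\<in>UNIV. cnj (K i) * K i)))"
      unfolding sum_distrib_left sum.distrib[symmetric]
      by (rule sum.cong[OF refl]) (simp add: li algebra_simps)
    also have "\<dots> = R + cnj \<rho> * \<rho> * of_real S"
      using zero by (simp add: S)
    finally have L: "(\<Sum>i\<in>UNIV. cnj (l i) * l i) = R + cnj \<rho> * \<rho> * of_real S" .
    have "(1 + cnj \<rho> * \<rho>) * of_real S = 0"
      using zero(1) unfolding L S by (simp add: algebra_simps)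
    moreover have "1 + cnj \<rho> * \<rho> = of_real (1 + (cmod \<rho>)\<^sup>2)"
      by (simp add: complex_norm_square mult.commute del: of_real_power)
    moreover have "1 + (cmod \<rho>)\<^sup>2 \<noteq> 0"
      by (smt (verit) zero_le_power2)
    ultimately have "S = 0"
      by (metis mult_eq_0_iff of_real_eq_0_iff)
    then have "(cmod (K k))\<^sup>2 = 0"
      unfolding S_def by (subst (asm) sum_nonneg_eq_0_iff) auto
    with k show False by simp
  qed
  show thesis
    by (rule that[of P Q l M]) (use inner det shP shQ K0 in \<open>simp_all add: e_def\<close>)
qed

lemma geometric_mindex:
  assumes "\<And>i \<gamma>. mdeg \<gamma> < r \<Longrightarrow> p (\<gamma> + Poly_Mapping.single i 1) = u i * p \<gamma>" "mdeg \<gamma> \<le> r"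
  shows "p \<gamma> = p 0 * monom_eval (\<chi> i. u i) \<gamma>"
  using assms(2)
proof (induction "mdeg \<gamma>" arbitrary: \<gamma>)
  case 0
  then show ?case using mdeg_eq_0_iff[of \<gamma>] by simp
next
  case (Suc k)
  obtain i \<beta> where \<beta>: "\<gamma> = \<beta> + Poly_Mapping.single i 1" "mdeg \<beta> = k"
    using Suc(2) by (metis mdeg_SucE)
  have "p \<gamma> = u i * p \<beta>"
    unfolding \<beta>(1) using Suc.hyps(2) Suc.prems \<beta>(2) by (intro assms(1)) simp
  also have "p \<beta> = p 0 * monom_eval (\<chi> i. u i) \<beta>"
    using Suc.hyps Suc.prems \<beta>(2) by simp
  finally show ?case
    unfolding \<beta>(1) monom_eval_add monom_eval_single by simp
qed

section \<open>Polynomials, localizing matrices and Dirac sequences\<close>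

lemma single_one_inject: "Poly_Mapping.single i (1::nat) = Poly_Mapping.single j 1 \<longleftrightarrow> i = j"
  by (metis lookup_single_eq lookup_single_not_eq zero_neq_one)

lemma mdeg_le_cdeg:
  assumes "(\<beta>, \<gamma>) \<in> Poly_Mapping.keys p"
  shows "mdeg \<beta> \<le> cdeg p" "mdeg \<gamma> \<le> cdeg p"
proof -
  have "max (mdeg \<beta>) (mdeg \<gamma>) \<le> cdeg p"
    unfolding cdeg_def by (rule Max_ge) (use assms in force)+
  then show "mdeg \<beta> \<le> cdeg p" "mdeg \<gamma> \<le> cdeg p" by simp_all
qed

lemma lookup_sphere_poly:
  "Poly_Mapping.lookup (sphere_poly R) \<kappa> =
    (\<Sum>i\<in>UNIV. 1 when (Poly_Mapping.single i 1, Poly_Mapping.single i 1) = \<kappa>) -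
    (of_real R when (0, 0) = \<kappa>)"
  by (simp add: sphere_poly_def lookup_minus lookup_sum lookup_single)

lemma keys_sphere_poly:
  "Poly_Mapping.keys (sphere_poly R) \<subseteq>
    insert (0, 0) (range (\<lambda>i. (Poly_Mapping.single i 1, Poly_Mapping.single i 1)))"
proof (rule subsetI, rule ccontr)
  fix \<kappa> :: "'a mindex \<times> 'a mindex"
  assume \<kappa>: "\<kappa> \<in> Poly_Mapping.keys (sphere_poly R)"
    "\<kappa> \<notin> insert (0, 0) (range (\<lambda>i. (Poly_Mapping.single i 1, Poly_Mapping.single i 1)))"
  then have "(Poly_Mapping.single i 1, Poly_Mapping.single i 1) \<noteq> \<kappa>" "(0, 0) \<noteq> \<kappa>" for i
    by blast+
  then have "Poly_Mapping.lookup (sphere_poly R) \<kappa> = 0"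
    unfolding lookup_sphere_poly by simp
  with \<kappa>(1) show False by (simp add: in_keys_iff)
qed

lemma cdeg_sphere_poly: "cdeg (sphere_poly R) \<le> 1"
  unfolding cdeg_def
proof (rule Max.boundedI)
  fix k
  assume "k \<in> insert 0 ((\<lambda>(\<beta>, \<gamma>). max (mdeg \<beta>) (mdeg \<gamma>)) ` Poly_Mapping.keys (sphere_poly R))"
  then show "k \<le> 1" using keys_sphere_poly[of R] by auto
qed auto

lemma localizing_matrix_sphere_poly:
  "localizing_matrix (sphere_poly R) y \<beta> \<gamma> =
    (\<Sum>i\<in>UNIV. y (\<beta> + Poly_Mapping.single i 1) (\<gamma> + Poly_Mapping.single i 1)) - R * y \<beta> \<gamma>"
proof -
  let ?e = "\<lambda>i::'a. Poly_Mapping.single i (1::nat)"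
  let ?F = "\<lambda>\<kappa>. Poly_Mapping.lookup (sphere_poly R) \<kappa> * y (\<beta> + fst \<kappa>) (\<gamma> + snd \<kappa>)"
  have e0: "?e i \<noteq> 0" for i
    by (metis mdeg_single mdeg_zero zero_neq_one)
  have "localizing_matrix (sphere_poly R) y \<beta> \<gamma> = (\<Sum>\<kappa>\<in>Poly_Mapping.keys (sphere_poly R). ?F \<kappa>)"
    by (simp add: localizing_matrix_def case_prod_beta')
  \<comment> \<open>The sum is enlarged to all possible exponent pairs; pairs that are not keys
    contribute 0.\<close>
  also have "\<dots> = (\<Sum>\<kappa>\<in>insert (0, 0) (range (\<lambda>i. (?e i, ?e i))). ?F \<kappa>)"
    by (rule sum.mono_neutral_left) (use keys_sphere_poly[of R] in \<open>auto simp: in_keys_iff\<close>)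
  also have "\<dots> = ?F (0, 0) + (\<Sum>\<kappa>\<in>range (\<lambda>i. (?e i, ?e i)). ?F \<kappa>)"
    by (rule sum.insert) (use e0 in \<open>auto simp: eq_commute[of 0]\<close>)
  also have "(\<Sum>\<kappa>\<in>range (\<lambda>i. (?e i, ?e i)). ?F \<kappa>) = (\<Sum>i\<in>UNIV. ?F (?e i, ?e i))"
    by (subst sum.reindex) (auto simp: inj_on_def single_one_inject[simplified])
  also have "\<dots> = (\<Sum>i\<in>UNIV. y (\<beta> + ?e i) (\<gamma> + ?e i))"
  proof (rule sum.cong[OF refl])
    fix j :: 'a
    have "Poly_Mapping.lookup (sphere_poly R) (?e j, ?e j) =
        (\<Sum>i\<in>UNIV. 1 when i = j) - (of_real R when False)"
      unfolding lookup_sphere_poly prod.inject single_one_inject using e0[of j, THEN not_sym]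
      by simp
    then show "?F (?e j, ?e j) = y (\<beta> + ?e j) (\<gamma> + ?e j)" by (simp add: when_def)
  qed
  also have "?F (0, 0) = - R * y \<beta> \<gamma>"
  proof -
    have "Poly_Mapping.lookup (sphere_poly R :: 'a cpoly) (0, 0) = - of_real R"
      unfolding lookup_sphere_poly prod.inject using e0 by simp
    then show ?thesis by simp
  qed
  finally show ?thesis by simp
qed

section \<open>Conjugation and polynomial values\<close>

lemma cpoly_eval_vcnj:
  assumes "real_coeffs p"
  shows "cpoly_eval p (vcnj z) = cnj (cpoly_eval p z)"
proof -
  have "cnj (Poly_Mapping.lookup p \<kappa>) = Poly_Mapping.lookup p \<kappa>" for \<kappa>
    using assms by (cases \<kappa>) (simp add: real_coeffs_def Reals_cnj_iff)
  then show ?thesis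
    by (simp add: cpoly_eval_def case_prod_beta' cnj_sum monom_eval_vcnj)
qed

text \<open>Exchanging the two exponents of a term conjugates its coefficient and its monomials, so
  conjugation only permutes the terms.\<close>

lemma cpoly_eval_self_conjugate:
  assumes "self_conjugate p"
  shows "cnj (cpoly_eval p z) = cpoly_eval p z"
proof -
  have sw: "Poly_Mapping.lookup p (\<gamma>, \<beta>) = cnj (Poly_Mapping.lookup p (\<beta>, \<gamma>))" for \<beta> \<gamma>
    using assms unfolding self_conjugate_def by blast
  have "cpoly_eval p z = (\<Sum>\<kappa>\<in>Poly_Mapping.keys p.
      cnj (Poly_Mapping.lookup p \<kappa> * monom_eval z (fst \<kappa>) * monom_eval (vcnj z) (snd \<kappa>)))"
    unfolding cpoly_eval_def
  proof (rule sum.reindex_bij_witness[of _ prod.swap prod.swap])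
    fix \<kappa> :: "'a mindex \<times> 'a mindex"
    assume \<kappa>: "\<kappa> \<in> Poly_Mapping.keys p"
    obtain \<beta> \<gamma> where bg: "\<kappa> = (\<beta>, \<gamma>)" by (cases \<kappa>)
    show "prod.swap \<kappa> \<in> Poly_Mapping.keys p"
      using \<kappa> unfolding bg in_keys_iff swap_simp sw[of \<gamma> \<beta>] by simp
    show "cnj (Poly_Mapping.lookup p (prod.swap \<kappa>) * monom_eval z (fst (prod.swap \<kappa>)) *
        monom_eval (vcnj z) (snd (prod.swap \<kappa>))) =
      (case \<kappa> of (\<beta>, \<gamma>) \<Rightarrow> Poly_Mapping.lookup p (\<beta>, \<gamma>) * monom_eval z \<beta> * monom_eval (vcnj z) \<gamma>)"
      unfolding bg swap_simp sw[of \<gamma> \<beta>] by (simp add: monom_eval_vcnj)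
  next
    fix \<kappa> :: "'a mindex \<times> 'a mindex"
    assume \<kappa>: "\<kappa> \<in> Poly_Mapping.keys p"
    obtain \<beta> \<gamma> where bg: "\<kappa> = (\<beta>, \<gamma>)" by (cases \<kappa>)
    show "prod.swap \<kappa> \<in> Poly_Mapping.keys p"
      using \<kappa> unfolding bg in_keys_iff swap_simp sw[of \<gamma> \<beta>] by simp
  qed auto
  then show ?thesis
    by (simp add: cpoly_eval_def case_prod_beta' cnj_sum)
qed

text \<open>These are the moments of the unit point mass at \<open>z\<close>; the second index is
  the one that belongs to the conjugate variables.\<close>

definition dirac_seq :: "complex ^ 'n::finite \<Rightarrow> 'n mseq" where
  "dirac_seq z \<beta> \<gamma> = monom_eval z \<beta> * cnj (monom_eval z \<gamma>)"

lemma riesz_dirac_seq: "riesz (dirac_seq z) p = cpoly_eval p z"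
  by (simp add: riesz_def cpoly_eval_def dirac_seq_def monom_eval_vcnj mult.assoc)

lemma localizing_matrix_dirac_seq:
  "localizing_matrix p (dirac_seq z) \<beta> \<gamma> = cpoly_eval p z * dirac_seq z \<beta> \<gamma>"
  by (simp add: localizing_matrix_def cpoly_eval_def dirac_seq_def monom_eval_vcnj monom_eval_add
      case_prod_beta' sum_distrib_left sum_distrib_right mult_ac)

lemma psd_on_dirac_seq:
  assumes "c \<ge> 0"
  shows "psd_on I (\<lambda>\<beta> \<gamma>. complex_of_real c * dirac_seq z \<beta> \<gamma>)"
  unfolding psd_on_def
proof (intro conjI ballI allI)
  fix v :: "'a mindex \<Rightarrow> complex"
  define S where "S = (\<Sum>\<beta>\<in>I. cnj (v \<beta>) * monom_eval z \<beta>)"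
  have "(\<Sum>\<beta>\<in>I. \<Sum>\<gamma>\<in>I. cnj (v \<beta>) * (complex_of_real c * dirac_seq z \<beta> \<gamma>) * v \<gamma>) =
      complex_of_real c * (S * cnj S)"
    by (simp add: S_def dirac_seq_def cnj_sum sum_product sum_distrib_left mult_ac)
  also have "\<dots> = of_real (c * (cmod S)\<^sup>2)"
    by (simp add: complex_norm_square del: of_real_power)
  finally show "0 \<le> Re (\<Sum>\<beta>\<in>I. \<Sum>\<gamma>\<in>I. cnj (v \<beta>) * (complex_of_real c * dirac_seq z \<beta> \<gamma>) * v \<gamma>)"
    using assms by simp
qed (simp add: dirac_seq_def)

text \<open>The localizing matrix of a point mass is the value of the polynomial times a positive
  semidefinite matrix of rank one. Self-conjugacy makes that value a real number.\<close>

lemma dirac_seq_feasible: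
  assumes "z \<in> cpop_feasible m g l h" and "\<And>i. i \<in> {1..m} \<Longrightarrow> self_conjugate (g i)"
  shows "dirac_seq z \<in> complex_relax_feasible m g l h r"
proof -
  have "psd_on I (localizing_matrix (g i) (dirac_seq z))" if i: "i \<in> {1..m}" for i I
  proof -
    have "cpoly_eval (g i) z = of_real (Re (cpoly_eval (g i) z))"
      using cpoly_eval_self_conjugate[OF assms(2)[OF i], of z]
      by (metis Reals_cnj_iff of_real_Re)
    then have "localizing_matrix (g i) (dirac_seq z) =
        (\<lambda>\<beta> \<gamma>. complex_of_real (Re (cpoly_eval (g i) z)) * dirac_seq z \<beta> \<gamma>)"
      by (intro ext) (simp add: localizing_matrix_dirac_seq)
    moreover have "Re (cpoly_eval (g i) z) \<ge> 0"
      using assms(1) i by (simp add: cpop_feasible_def)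
    ultimately show ?thesis using psd_on_dirac_seq by metis
  qed
  moreover have "zero_on I (localizing_matrix (h i) (dirac_seq z))" if i: "i \<in> {1..l}" for i I
    using assms(1) i by (simp add: zero_on_def localizing_matrix_dirac_seq cpop_feasible_def)
  moreover have "psd_on I (moment_matrix (dirac_seq z))" for I
  proof -
    have "moment_matrix (dirac_seq z) = (\<lambda>\<beta> \<gamma>. complex_of_real 1 * dirac_seq z \<beta> \<gamma>)"
      by (intro ext) (simp add: moment_matrix_def)
    with psd_on_dirac_seq[OF zero_le_one] show ?thesis by metis
  qed
  moreover have "pseudo_moment (dirac_seq z)" "dirac_seq z 0 0 = 1"
    by (simp_all add: pseudo_moment_def dirac_seq_def)
  ultimately show ?thesis
    unfolding complex_relax_feasible_def by blast
qed

section \<open>Dependence on low-order moments and linearity in the sequence\<close>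

lemma riesz_cong:
  assumes "\<And>\<beta> \<gamma>. mdeg \<beta> \<le> r \<Longrightarrow> mdeg \<gamma> \<le> r \<Longrightarrow> y \<beta> \<gamma> = y' \<beta> \<gamma>" "cdeg p \<le> r"
  shows "riesz y p = riesz y' p"
  unfolding riesz_def
proof (rule sum.cong[OF refl], clarify)
  fix \<beta> \<gamma> assume "(\<beta>, \<gamma>) \<in> Poly_Mapping.keys p"
  then have "y \<beta> \<gamma> = y' \<beta> \<gamma>"
    using mdeg_le_cdeg[of \<beta> \<gamma> p] assms by simp
  then show "Poly_Mapping.lookup p (\<beta>, \<gamma>) * y \<beta> \<gamma> = Poly_Mapping.lookup p (\<beta>, \<gamma>) * y' \<beta> \<gamma>" by simp
qed

lemma localizing_matrix_cong:
  assumes "\<And>\<beta> \<gamma>. mdeg \<beta> \<le> r \<Longrightarrow> mdeg \<gamma> \<le> r \<Longrightarrow> y \<beta> \<gamma> = y' \<beta> \<gamma>"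
    and "mdeg \<alpha> + cdeg p \<le> r" "mdeg \<delta> + cdeg p \<le> r"
  shows "localizing_matrix p y \<alpha> \<delta> = localizing_matrix p y' \<alpha> \<delta>"
  unfolding localizing_matrix_def
proof (rule sum.cong[OF refl], clarify)
  fix \<beta> \<gamma> assume "(\<beta>, \<gamma>) \<in> Poly_Mapping.keys p"
  then have "y (\<alpha> + \<beta>) (\<delta> + \<gamma>) = y' (\<alpha> + \<beta>) (\<delta> + \<gamma>)"
    using mdeg_le_cdeg[of \<beta> \<gamma> p] assms(2,3) by (intro assms(1)) simp_all
  then show "Poly_Mapping.lookup p (\<beta>, \<gamma>) * y (\<alpha> + \<beta>) (\<delta> + \<gamma>) =
    Poly_Mapping.lookup p (\<beta>, \<gamma>) * y' (\<alpha> + \<beta>) (\<delta> + \<gamma>)" by simp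
qed

lemma riesz_combination:
  "riesz (\<lambda>\<beta> \<gamma>. a * y \<beta> \<gamma> + b * y' \<beta> \<gamma>) p = a * riesz y p + b * riesz y' p"
  by (simp add: riesz_def case_prod_beta' sum_distrib_left sum.distrib algebra_simps)

lemma localizing_matrix_combination:
  "localizing_matrix p (\<lambda>\<beta> \<gamma>. a * y \<beta> \<gamma> + b * y' \<beta> \<gamma>) \<alpha> \<delta> =
    a * localizing_matrix p y \<alpha> \<delta> + b * localizing_matrix p y' \<alpha> \<delta>"
  by (simp add: localizing_matrix_def case_prod_beta' sum_distrib_left sum.distrib algebra_simps)

section \<open>Real parts of complex pseudo-moment sequences\<close>

lemma Re_real_coeffs_mult:
  assumes "real_coeffs p"
  shows "complex_of_real (Re (Poly_Mapping.lookup p \<kappa> * c)) = Poly_Mapping.lookup p \<kappa> * of_real (Re c)"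
proof -
  have "Poly_Mapping.lookup p \<kappa> \<in> \<real>"
    using assms by (cases \<kappa>) (simp add: real_coeffs_def)
  then obtain x where "Poly_Mapping.lookup p \<kappa> = of_real x"
    by (rule Reals_cases)
  then show ?thesis by simp
qed

lemma localizing_matrix_Re:
  assumes "real_coeffs p"
  shows "localizing_matrix p (\<lambda>\<beta> \<gamma>. of_real (Re (y \<beta> \<gamma>))) \<alpha> \<delta> = of_real (Re (localizing_matrix p y \<alpha> \<delta>))"
  by (simp only: localizing_matrix_def case_prod_beta' Re_sum of_real_sum
      Re_real_coeffs_mult[OF assms])

lemma riesz_Re:
  assumes "real_coeffs p"
  shows "riesz (\<lambda>\<beta> \<gamma>. of_real (Re (y \<beta> \<gamma>))) p = of_real (Re (riesz y p))"
  by (simp only: riesz_def case_prod_beta' Re_sum of_real_sum Re_real_coeffs_mult[OF assms])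

text \<open>The real part is the average of the matrix and its entrywise conjugate. The form of the
  conjugate matrix at \<open>v\<close> is the conjugate of the original form at the conjugate of
  \<open>v\<close>, hence nonnegative as well.\<close>

lemma psd_on_Re:
  assumes "psd_on I A"
  shows "psd_on I (\<lambda>\<beta> \<gamma>. of_real (Re (A \<beta> \<gamma>)))"
  unfolding psd_on_def
proof (intro conjI ballI allI)
  fix \<beta> \<gamma> assume "\<beta> \<in> I" "\<gamma> \<in> I"
  then have "A \<gamma> \<beta> = cnj (A \<beta> \<gamma>)" using assms unfolding psd_on_def by blast
  then show "complex_of_real (Re (A \<gamma> \<beta>)) = cnj (complex_of_real (Re (A \<beta> \<gamma>)))" by simp
next
  fix v :: "'a \<Rightarrow> complex"
  define S where "S = (\<lambda>v. \<Sum>\<beta>\<in>I. \<Sum>\<gamma>\<in>I. cnj (v \<beta>) * A \<beta> \<gamma> * v \<gamma>)"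
  have pos: "0 \<le> Re (S v)" for v
    using assms unfolding psd_on_def S_def by blast
  have twice: "2 * (a * complex_of_real (Re x) * b) = a * x * b + cnj (cnj a * x * cnj b)" for a b x
  proof -
    have "complex_of_real (2 * Re x) = x + cnj x" by (simp only: complex_add_cnj)
    moreover have "2 * (a * complex_of_real (Re x) * b) = a * complex_of_real (2 * Re x) * b" by simp
    ultimately show ?thesis by (simp add: algebra_simps)
  qed
  define T where "T = (\<Sum>\<beta>\<in>I. \<Sum>\<gamma>\<in>I. cnj (v \<beta>) * of_real (Re (A \<beta> \<gamma>)) * v \<gamma>)"
  have "2 * T = S v + cnj (S (\<lambda>i. cnj (v i)))"
    unfolding T_def S_def sum_distrib_left cnj_sum sum.distrib[symmetric] twice by simp
  from arg_cong[OF this, of Re] have "2 * Re T = Re (S v) + Re (S (\<lambda>i. cnj (v i)))"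
    by simp
  then show "0 \<le> Re (\<Sum>\<beta>\<in>I. \<Sum>\<gamma>\<in>I. cnj (v \<beta>) * of_real (Re (A \<beta> \<gamma>)) * v \<gamma>)"
    using pos[of v] pos[of "\<lambda>i. cnj (v i)"] unfolding T_def[symmetric] by linarith
qed

lemma Re_real_relax_feasible:
  assumes "y \<in> complex_relax_feasible m g l h r"
    and "\<And>i. i \<in> {1..m} \<Longrightarrow> real_coeffs (g i)" "\<And>i. i \<in> {1..l} \<Longrightarrow> real_coeffs (h i)"
  shows "(\<lambda>\<beta> \<gamma>. of_real (Re (y \<beta> \<gamma>))) \<in> real_relax_feasible m g l h r"
proof -
  let ?y = "\<lambda>\<beta> \<gamma>. complex_of_real (Re (y \<beta> \<gamma>))"
  have y: "pseudo_moment y" "psd_on (mindices r) (moment_matrix y)"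
    "\<And>i. i \<in> {1..m} \<Longrightarrow> psd_on (mindices (r - cdeg (g i))) (localizing_matrix (g i) y)"
    "\<And>i. i \<in> {1..l} \<Longrightarrow> zero_on (mindices (r - cdeg (h i))) (localizing_matrix (h i) y)" "y 0 0 = 1"
    using assms(1) unfolding complex_relax_feasible_def by blast+
  have loc: "localizing_matrix p ?y = (\<lambda>\<beta> \<gamma>. of_real (Re (localizing_matrix p y \<beta> \<gamma>)))"
    if "real_coeffs p" for p
    by (intro ext) (rule localizing_matrix_Re[OF that])
  have "pseudo_moment ?y"
    using y(1) unfolding pseudo_moment_def by (metis cnj.sel(1) complex_cnj_complex_of_real)
  moreover have "psd_on (mindices r) (moment_matrix ?y)"
    using psd_on_Re[OF y(2)] unfolding moment_matrix_def .
  moreover have "psd_on (mindices (r - cdeg (g i))) (localizing_matrix (g i) ?y)"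
    if "i \<in> {1..m}" for i
    unfolding loc[OF assms(2)[OF that]] by (rule psd_on_Re[OF y(3)[OF that]])
  moreover have "zero_on (mindices (r - cdeg (h i))) (localizing_matrix (h i) ?y)"
    if "i \<in> {1..l}" for i
    unfolding loc[OF assms(3)[OF that]] using y(4)[OF that] by (simp add: zero_on_def)
  ultimately show ?thesis
    using y(5) by (simp add: real_relax_feasible_def complex_relax_feasible_def)
qed

text \<open>The test vector with entry \<open>\<nu> b\<close> at \<open>a\<close> and
  \<open>- \<nu> a\<close> at \<open>b\<close> is annihilated by \<open>\<nu>\<close>. The
  \<open>d\<close> term drops out, and what remains is \<open>c\<close> times a positive
  number.\<close>

lemma psd_on_two_atoms_nonneg:
  assumes "finite I" "psd_on I A" "a \<in> I" "b \<in> I" "\<mu> a * \<nu> b \<noteq> \<mu> b * \<nu> a"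
    and A: "\<And>i j. i \<in> {a, b} \<Longrightarrow> j \<in> {a, b} \<Longrightarrow>
      A i j = c * (cnj (\<mu> i) * \<mu> j) + d * (cnj (\<nu> i) * \<nu> j)"
  shows "Re c \<ge> 0"
proof -
  define \<Delta> where "\<Delta> = \<mu> a * \<nu> b - \<mu> b * \<nu> a"
  have "a \<noteq> b" using assms(5) by (auto simp: mult.commute)
  then have "0 \<le> Re (cnj (\<nu> b) * (A a a * \<nu> b + A a b * (- \<nu> a)) +
      cnj (- \<nu> a) * (A b a * \<nu> b + A b b * (- \<nu> a)))"
    using psd_on_two_points[OF assms(1-4)] by blast
  also have "cnj (\<nu> b) * (A a a * \<nu> b + A a b * (- \<nu> a)) +
      cnj (- \<nu> a) * (A b a * \<nu> b + A b b * (- \<nu> a)) = c * (\<Delta> * cnj \<Delta>)"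
    by (simp add: A \<Delta>_def algebra_simps)
  also have "\<dots> = c * of_real ((cmod \<Delta>)\<^sup>2)"
    by (simp only: complex_norm_square)
  also have "Re \<dots> = Re c * (cmod \<Delta>)\<^sup>2"
    by (simp del: of_real_power)
  finally show ?thesis
    using assms(5) by (simp add: \<Delta>_def zero_le_mult_iff)
qed

section \<open>Extraction of the two minimizers\<close>

text \<open>The shifts scale the two diagonal coordinates, so each coordinate is a multiple of a
  monomial evaluation and each contributes one atom. The indices \<open>a\<close> and
  \<open>b\<close> are kept in the conclusion because their monomials separate the atoms at low
  degree.\<close>

lemma two_atom_representation:
  fixes y :: "'n::finite mseq"
  assumes psd: "psd_on (mindices r) (moment_matrix y)"
    and sphere: "zero_on (mindices (r - 1)) (localizing_matrix (sphere_poly R) y)"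
    and "2 \<le> d" "d \<le> r"
    and rank: "rank_on (mindices r) (moment_matrix y) = 2"
      "rank_on (mindices (r - d)) (moment_matrix y) = 2"
  obtains u v w w' a b where
    "\<And>\<beta> \<gamma>. mdeg \<beta> \<le> r \<Longrightarrow> mdeg \<gamma> \<le> r \<Longrightarrow>
      y \<beta> \<gamma> = complex_of_real w * dirac_seq u \<beta> \<gamma> + complex_of_real w' * dirac_seq v \<beta> \<gamma>"
    "0 < w" "0 < w'" "a \<in> mindices (r - d)" "b \<in> mindices (r - d)"
    "monom_eval u a * monom_eval v b \<noteq> monom_eval u b * monom_eval v a"
proof -
  have sub: "mindices (r - d) \<subseteq> (mindices r :: 'n mindex set)"
    by (auto simp: mindices_def)
  obtain p q a b where ab: "a \<in> mindices (r - d)" "b \<in> mindices (r - d)" "p a * q b \<noteq> p b * q a"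
    and pq0: "\<And>\<beta> \<gamma>. \<beta> \<in> mindices r \<Longrightarrow> \<gamma> \<in> mindices r \<Longrightarrow>
      moment_matrix y \<beta> \<gamma> = cnj (p \<beta>) * p \<gamma> + cnj (q \<beta>) * q \<gamma>"
    using rank_two_psd_factorization[OF finite_mindices sub psd rank] by metis
  have pq: "y \<beta> \<gamma> = cnj (p \<beta>) * p \<gamma> + cnj (q \<beta>) * q \<gamma>" if "mdeg \<beta> \<le> r" "mdeg \<gamma> \<le> r" for \<beta> \<gamma>
    using pq0[of \<beta> \<gamma>] that by (simp add: mindices_def moment_matrix_def)
  have deg: "Suc (mdeg a) < r" "Suc (mdeg b) < r" "mdeg a \<le> r" "mdeg b \<le> r"
    using ab assms(3,4) by (auto simp: mindices_def)
  have sph: "(\<Sum>i\<in>UNIV. cnj (p (\<beta> + Poly_Mapping.single i 1)) * p (\<gamma> + Poly_Mapping.single i 1) +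
        cnj (q (\<beta> + Poly_Mapping.single i 1)) * q (\<gamma> + Poly_Mapping.single i 1)) =
      complex_of_real R * (cnj (p \<beta>) * p \<gamma> + cnj (q \<beta>) * q \<gamma>)"
    if "mdeg \<beta> < r" "mdeg \<gamma> < r" for \<beta> \<gamma>
  proof -
    have "localizing_matrix (sphere_poly R) y \<beta> \<gamma> = 0"
      using sphere that unfolding zero_on_def by (auto simp: mindices_def)
    then have "(\<Sum>i\<in>UNIV. y (\<beta> + Poly_Mapping.single i 1) (\<gamma> + Poly_Mapping.single i 1)) = R * y \<beta> \<gamma>"
      unfolding localizing_matrix_sphere_poly by simp
    moreover have "y (\<beta> + Poly_Mapping.single i 1) (\<gamma> + Poly_Mapping.single i 1) =
        cnj (p (\<beta> + Poly_Mapping.single i 1)) * p (\<gamma> + Poly_Mapping.single i 1) +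
        cnj (q (\<beta> + Poly_Mapping.single i 1)) * q (\<gamma> + Poly_Mapping.single i 1)" for i
      using that by (intro pq) (simp_all only: mdeg_add mdeg_single)
    ultimately show ?thesis
      using that by (simp only: pq less_imp_le)
  qed
  obtain P Q U V where
    PQ: "\<And>\<beta> \<gamma>. cnj (p \<beta>) * p \<gamma> + cnj (q \<beta>) * q \<gamma> = cnj (P \<beta>) * P \<gamma> + cnj (Q \<beta>) * Q \<gamma>"
    and det: "P a * Q b \<noteq> P b * Q a"
    and shP: "\<And>i \<gamma>. mdeg \<gamma> < r \<Longrightarrow> P (\<gamma> + Poly_Mapping.single i 1) = U i * P \<gamma>"
    and shQ: "\<And>i \<gamma>. mdeg \<gamma> < r \<Longrightarrow> Q (\<gamma> + Poly_Mapping.single i 1) = V i * Q \<gamma>"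
    using spherical_pair_diagonal[OF sph deg(1,2) ab(3)] by metis
  \<comment> \<open>The Gram form conjugates the factor of the first index, whereas
    \<open>dirac_seq\<close> conjugates that of the second. The atoms are therefore the conjugates
    of the eigenvalue vectors.\<close>
  define u v where "u = vcnj (\<chi> i. U i)" and "v = vcnj (\<chi> i. V i)"
  have P: "P \<gamma> = P 0 * cnj (monom_eval u \<gamma>)" if "mdeg \<gamma> \<le> r" for \<gamma>
    using geometric_mindex[of r P U, OF shP that] by (simp add: u_def monom_eval_vcnj)
  have Q: "Q \<gamma> = Q 0 * cnj (monom_eval v \<gamma>)" if "mdeg \<gamma> \<le> r" for \<gamma>
    using geometric_mindex[of r Q V, OF shQ that] by (simp add: v_def monom_eval_vcnj)
  \<comment> \<open>With \<open>P 0\<close> and \<open>Q 0\<close> factored out, the determinant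
    shows at once that both weights are nonzero and that the monomials separate the atoms.\<close>
  have det': "P 0 * Q 0 * cnj (monom_eval u a * monom_eval v b) \<noteq>
      P 0 * Q 0 * cnj (monom_eval u b * monom_eval v a)"
    using det unfolding P[OF deg(3)] P[OF deg(4)] Q[OF deg(3)] Q[OF deg(4)]
    by (simp add: mult_ac)
  show thesis
  proof (rule that[OF _ _ _ ab(1,2), of "(cmod (P 0))\<^sup>2" u "(cmod (Q 0))\<^sup>2" v])
    fix \<beta> \<gamma> :: "'n mindex" assume *: "mdeg \<beta> \<le> r" "mdeg \<gamma> \<le> r"
    show "y \<beta> \<gamma> = complex_of_real ((cmod (P 0))\<^sup>2) * dirac_seq u \<beta> \<gamma> +
        complex_of_real ((cmod (Q 0))\<^sup>2) * dirac_seq v \<beta> \<gamma>"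
      unfolding pq[OF *] PQ P[OF *(1)] P[OF *(2)] Q[OF *(1)] Q[OF *(2)] complex_norm_square
      by (simp add: dirac_seq_def)
  next
    show "0 < (cmod (P 0))\<^sup>2" "0 < (cmod (Q 0))\<^sup>2"
      using det' by auto
    show "monom_eval u a * monom_eval v b \<noteq> monom_eval u b * monom_eval v a"
      using det' by metis
  qed
qed

section \<open>Comparison of optimal values and conclusion\<close>

lemma cpop_optimal_vcnj:
  assumes "cpop_optimal f m g l h z" "real_coeffs f"
    and "\<And>i. i \<in> {1..m} \<Longrightarrow> real_coeffs (g i)" "\<And>i. i \<in> {1..l} \<Longrightarrow> real_coeffs (h i)"
  shows "cpop_optimal f m g l h (vcnj z)"
  using assms(1) unfolding cpop_optimal_def cpop_feasible_def
  by (simp add: cpoly_eval_vcnj assms(2-4))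

text \<open>Real feasible sequences are complex feasible. Conversely, taking real parts preserves
  feasibility and the objective, because all coefficients are real.\<close>

lemma real_relax_value_eq_theta:
  assumes "real_relax_optimal f m g l h r y" "real_coeffs f"
    and "\<And>i. i \<in> {1..m} \<Longrightarrow> real_coeffs (g i)" "\<And>i. i \<in> {1..l} \<Longrightarrow> real_coeffs (h i)"
  shows "theta f m g l h r = ereal (Re (riesz y f))"
proof (rule antisym)
  show "theta f m g l h r \<le> ereal (Re (riesz y f))"
    unfolding theta_def
    by (rule INF_lower) (use assms(1) in \<open>simp add: real_relax_optimal_def real_relax_feasible_def\<close>)
  show "ereal (Re (riesz y f)) \<le> theta f m g l h r"
    unfolding theta_def
  proof (rule INF_greatest)
    fix y' assume y': "y' \<in> complex_relax_feasible m g l h r"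
    have "ereal (Re (riesz y f)) = (INF y\<in>real_relax_feasible m g l h r. ereal (Re (riesz y f)))"
      using assms(1) unfolding real_relax_optimal_def by blast
    also have "\<dots> \<le> ereal (Re (riesz (\<lambda>\<beta> \<gamma>. of_real (Re (y' \<beta> \<gamma>))) f))"
      by (rule INF_lower) (rule Re_real_relax_feasible[OF y' assms(3,4)])
    finally show "ereal (Re (riesz y f)) \<le> ereal (Re (riesz y' f))"
      unfolding riesz_Re[OF assms(2)] by simp
  qed
qed

lemma theta_le_f_min:
  assumes "\<And>i. i \<in> {1..m} \<Longrightarrow> self_conjugate (g i)"
  shows "theta f m g l h r \<le> f_min f m g l h"
  unfolding f_min_def
proof (rule INF_greatest)
  fix z assume "z \<in> cpop_feasible m g l h"
  then have "dirac_seq z \<in> complex_relax_feasible m g l h r"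
    using assms by (rule dirac_seq_feasible)
  then show "theta f m g l h r \<le> ereal (Re (cpoly_eval f z))"
    unfolding theta_def riesz_dirac_seq[symmetric] by (rule INF_lower)
qed

theorem theorem4p3:
  fixes f :: "'n::finite cpoly"
    and g h :: "nat \<Rightarrow> 'n cpoly"
    and m l r :: nat
    and R :: real
    and y :: "'n mseq"
  assumes "real_coeffs f" "self_conjugate f"
    and "\<And>i. i \<in> {1..m} \<Longrightarrow> real_coeffs (g i) \<and> self_conjugate (g i)"
    and "\<And>i. i \<in> {1..l} \<Longrightarrow> real_coeffs (h i) \<and> self_conjugate (h i)"
    and "R > 0"
    and "\<exists>i\<in>{1..l}. h i = sphere_poly R"
    and "r \<ge> max (d_K m g l h) (d_min f m g l h)"
    and "real_relax_optimal f m g l h r y"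
    and "rank_on (mindices r) (moment_matrix y) = 2"
    and "rank_on (mindices (r - d_K m g l h)) (moment_matrix y) = 2"
  shows "theta f m g l h r = f_min f m g l h \<and>
    ((\<exists>u v. u \<noteq> v \<and> real_point u \<and> real_point v \<and>
        cpop_optimal f m g l h u \<and> cpop_optimal f m g l h v) \<or>
     (\<exists>z. z \<noteq> vcnj z \<and> cpop_optimal f m g l h z \<and> cpop_optimal f m g l h (vcnj z)))"
proof -
  define d where "d = d_K m g l h"
  have real: "\<And>i. i \<in> {1..m} \<Longrightarrow> real_coeffs (g i)" "\<And>i. i \<in> {1..l} \<Longrightarrow> real_coeffs (h i)"
    using assms(3,4) by blast+
  have d2: "2 \<le> d" and dg: "\<And>i. i \<in> {1..m} \<Longrightarrow> cdeg (g i) \<le> d"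
    and dh: "\<And>i. i \<in> {1..l} \<Longrightarrow> cdeg (h i) \<le> d"
    unfolding d_def d_K_def by (rule Max_ge; simp)+
  have "cdeg f \<le> d_min f m g l h"
    unfolding d_min_def by (rule Max_ge) simp_all
  then have rd: "d \<le> r" "cdeg f \<le> r"
    using assms(7) by (simp_all add: d_def)
  have "y \<in> complex_relax_feasible m g l h r"
    using assms(8) by (simp add: real_relax_optimal_def real_relax_feasible_def)
  then have psd: "psd_on (mindices r) (moment_matrix y)"
    and psd_g: "\<And>i. i \<in> {1..m} \<Longrightarrow> psd_on (mindices (r - cdeg (g i))) (localizing_matrix (g i) y)"
    and zero_h: "\<And>i. i \<in> {1..l} \<Longrightarrow> zero_on (mindices (r - cdeg (h i))) (localizing_matrix (h i) y)"
    and y00: "y 0 0 = 1"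
    unfolding complex_relax_feasible_def by blast+
  obtain k where k: "k \<in> {1..l}" "h k = sphere_poly R"
    using assms(6) by blast
  \<comment> \<open>The sphere polynomial has \<open>cdeg\<close> at most 1, so the indices up to
    \<open>r - 1\<close> are among those covered by its localizing constraint.\<close>
  have sphere: "zero_on (mindices (r - 1)) (localizing_matrix (sphere_poly R) y)"
    using zero_h[OF k(1)] cdeg_sphere_poly[where 'a = 'n, of R]
    unfolding zero_on_def mindices_def k(2) by auto
  obtain u v w w' a b where
    rep: "\<And>\<beta> \<gamma>. mdeg \<beta> \<le> r \<Longrightarrow> mdeg \<gamma> \<le> r \<Longrightarrow>
      y \<beta> \<gamma> = complex_of_real w * dirac_seq u \<beta> \<gamma> + complex_of_real w' * dirac_seq v \<beta> \<gamma>"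
    and w: "0 < w" "0 < w'"
    and ab: "a \<in> mindices (r - d)" "b \<in> mindices (r - d)"
    and det: "monom_eval u a * monom_eval v b \<noteq> monom_eval u b * monom_eval v a"
    using two_atom_representation[OF psd sphere d2 rd(1) assms(9) assms(10)[folded d_def]] by metis
  \<comment> \<open>The degrees of \<open>a\<close> and \<open>b\<close> are at most
    \<open>r - d\<close>, so these entries involve only moments of order up to \<open>r\<close>,
    where the two-atom formula holds.\<close>
  have loc: "localizing_matrix p y \<alpha> \<delta> =
      complex_of_real w * cpoly_eval p u * (monom_eval u \<alpha> * cnj (monom_eval u \<delta>)) +
      complex_of_real w' * cpoly_eval p v * (monom_eval v \<alpha> * cnj (monom_eval v \<delta>))"
    if "cdeg p \<le> d" "\<alpha> \<in> {a, b}" "\<delta> \<in> {a, b}" for p \<alpha> \<delta>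
  proof -
    have "mdeg \<alpha> + cdeg p \<le> r" "mdeg \<delta> + cdeg p \<le> r"
      using that ab rd by (auto simp: mindices_def)
    then have "localizing_matrix p y \<alpha> \<delta> = localizing_matrix p
        (\<lambda>\<beta> \<gamma>. complex_of_real w * dirac_seq u \<beta> \<gamma> + complex_of_real w' * dirac_seq v \<beta> \<gamma>) \<alpha> \<delta>"
      by (intro localizing_matrix_cong[of r]) (rule rep)
    then show ?thesis
      unfolding localizing_matrix_combination localizing_matrix_dirac_seq
      by (simp add: dirac_seq_def mult.assoc)
  qed
  \<comment> \<open>The two lemmas on pairs conjugate the first factor while
    \<open>dirac_seq\<close> conjugates the second, so both are applied to conjugated
    monomials.\<close>
  have det_cnj: "cnj (monom_eval u a) * cnj (monom_eval v b) \<noteq>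
      cnj (monom_eval u b) * cnj (monom_eval v a)"
    using det by (metis complex_cnj_cancel_iff complex_cnj_mult)
  then have det_cnj': "cnj (monom_eval v a) * cnj (monom_eval u b) \<noteq>
      cnj (monom_eval v b) * cnj (monom_eval u a)"
    by (metis mult.commute)
  have g_nonneg: "0 \<le> Re (cpoly_eval (g i) u)" "0 \<le> Re (cpoly_eval (g i) v)"
    if i: "i \<in> {1..m}" for i
  proof -
    have ab': "a \<in> mindices (r - cdeg (g i))" "b \<in> mindices (r - cdeg (g i))"
      using ab dg[OF i] by (auto simp: mindices_def)
    have "0 \<le> Re (complex_of_real w * cpoly_eval (g i) u)"
      by (rule psd_on_two_atoms_nonneg[OF finite_mindices psd_g[OF i] ab' det_cnj,
            where d = "complex_of_real w' * cpoly_eval (g i) v"])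
        (simp add: loc[OF dg[OF i]])
    then show "0 \<le> Re (cpoly_eval (g i) u)"
      using w by (simp add: zero_le_mult_iff)
    have "0 \<le> Re (complex_of_real w' * cpoly_eval (g i) v)"
      by (rule psd_on_two_atoms_nonneg[OF finite_mindices psd_g[OF i] ab' det_cnj',
            where d = "complex_of_real w * cpoly_eval (g i) u"])
        (simp add: loc[OF dg[OF i]] add.commute)
    then show "0 \<le> Re (cpoly_eval (g i) v)"
      using w by (simp add: zero_le_mult_iff)
  qed
  have h_zero: "cpoly_eval (h i) u = 0" "cpoly_eval (h i) v = 0" if i: "i \<in> {1..l}" for i
  proof -
    have "a \<in> mindices (r - cdeg (h i))" "b \<in> mindices (r - cdeg (h i))"
      using ab dh[OF i] by (auto simp: mindices_def)
    then have z: "localizing_matrix (h i) y \<alpha> \<delta> = 0" if "\<alpha> \<in> {a, b}" "\<delta> \<in> {a, b}" for \<alpha> \<delta>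
      using zero_h[OF i] that unfolding zero_on_def by blast
    \<comment> \<open>The vanishing entries are written as a sesquilinear form with diagonal matrix,
      whose diagonal holds the weighted values of \<open>h i\<close> at the atoms.\<close>
    have form: "cnj (cnj (monom_eval u \<alpha>)) * (complex_of_real w * cpoly_eval (h i) u *
          cnj (monom_eval u \<delta>) + 0 * cnj (monom_eval v \<delta>)) +
        cnj (cnj (monom_eval v \<alpha>)) * (0 * cnj (monom_eval u \<delta>) +
          complex_of_real w' * cpoly_eval (h i) v * cnj (monom_eval v \<delta>)) = 0"
      if "\<alpha> \<in> {a, b}" "\<delta> \<in> {a, b}" for \<alpha> \<delta>
      using z[OF that] unfolding loc[OF dh[OF i] that] by (simp add: mult_ac)
    have "complex_of_real w * cpoly_eval (h i) u = 0" "complex_of_real w' * cpoly_eval (h i) v = 0"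
      using sesquilinear_pair_zero(1,4)[OF det_cnj form[of a a] form[of a b] form[of b a] form[of b b]]
      by blast+
    then show "cpoly_eval (h i) u = 0" "cpoly_eval (h i) v = 0" using w by simp_all
  qed
  have feas: "u \<in> cpop_feasible m g l h" "v \<in> cpop_feasible m g l h"
    using g_nonneg h_zero by (simp_all add: cpop_feasible_def)
  define F where "F = Re (riesz y f)"
  have theta: "theta f m g l h r = ereal F"
    unfolding F_def by (rule real_relax_value_eq_theta[OF assms(8,1) real])
  have le: "ereal F \<le> f_min f m g l h"
    unfolding theta[symmetric] by (rule theta_le_f_min) (use assms(3) in blast)
  have up: "f_min f m g l h \<le> ereal (Re (cpoly_eval f u))" "f_min f m g l h \<le> ereal (Re (cpoly_eval f v))"
    unfolding f_min_def by (rule INF_lower[OF feas(1)], rule INF_lower[OF feas(2)])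
  have "riesz y f = complex_of_real w * cpoly_eval f u + complex_of_real w' * cpoly_eval f v"
    using riesz_cong[OF rep rd(2)] by (simp add: riesz_combination riesz_dirac_seq)
  then have F: "F = w * Re (cpoly_eval f u) + w' * Re (cpoly_eval f v)"
    by (simp add: F_def)
  have "complex_of_real (w + w') = 1"
    using rep[of 0 0] y00 by (simp add: dirac_seq_def)
  then have ww: "w + w' = 1"
    by (metis of_real_eq_1_iff)
  have Fle: "F \<le> Re (cpoly_eval f u)" "F \<le> Re (cpoly_eval f v)"
    using order_trans[OF le up(1)] order_trans[OF le up(2)] by simp_all
  \<comment> \<open>The relaxation value is a convex combination, with positive weights, of two
    objective values that are each at least \<open>F\<close>. Hence both equal
    \<open>F\<close>.\<close>
  have "w * (Re (cpoly_eval f u) - F) + w' * (Re (cpoly_eval f v) - F) =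
      (w * Re (cpoly_eval f u) + w' * Re (cpoly_eval f v)) - (w + w') * F"
    by (simp add: algebra_simps)
  also have "\<dots> = 0" using F ww by simp
  finally have "w * (Re (cpoly_eval f u) - F) = 0 \<and> w' * (Re (cpoly_eval f v) - F) = 0"
    using w Fle by (subst (asm) add_nonneg_eq_0_iff) simp_all
  then have vals: "Re (cpoly_eval f u) = F" "Re (cpoly_eval f v) = F"
    using w by simp_all
  then have fmin: "f_min f m g l h = ereal F"
    using le up(1) by (intro antisym) simp_all
  have opt: "cpop_optimal f m g l h u" "cpop_optimal f m g l h v"
    using feas vals fmin by (simp_all add: cpop_optimal_def)
  \<comment> \<open>Equal atoms would make the two products in \<open>det\<close> agree. If both
    atoms are real, the first alternative holds; otherwise a non-real one and its conjugate give the
    second.\<close>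
  have "u \<noteq> v" using det by (auto simp: mult.commute)
  moreover have "\<exists>z. z \<noteq> vcnj z \<and> cpop_optimal f m g l h z \<and> cpop_optimal f m g l h (vcnj z)"
    if "cpop_optimal f m g l h z" "\<not> real_point z" for z
    using that cpop_optimal_vcnj[OF that(1) assms(1) real] unfolding real_point_iff_vcnj by metis
  ultimately show ?thesis
    using opt theta fmin by metis
qed

end
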